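(* Let $G$ be a connected graph and let $z(G)$ be the number of distinct roots of the matching polynomial of $G$. (i) If $z(G)=2$, then $G\simeq K_2$. (ii) If $z(G)=3$, then $G$ is either a star or $K_3$. (iii) If $z(G)=4$, then $G$ is a (connected) non-star graph with $4$ vertices. (iv) If $z(G)=5$, then $G$ is (isomorphic to) one of the graphs $K(k,t;\ell)$, $K'(k,t;\ell)$, $L(t,\ell)$, $T(r,k)$, $S(r,s)$, for some integers $k,r,s,t,\ell$ (in the ranges for which these graphs are defined), or a connected non-star graph with $5$ vertices.
   Context: All graphs are finite, simple and undirected. For a graph $G$ of order $n$ (number of vertices), $m(G,k)$ is the number of $k$-matchings (sets of $k$ pairwise nonincident edges), $m(G,0)=1$, and the matching polynomial of $G$ is $\mu(G,x)=\sum_{k\ge 0}(-1)^k m(G,k)x^{n-2k}$. Its roots (all real) are the matching roots of $G$. $K_n$ is the complete graph of order $n$; a star is a graph $K_{1,s}$; its center is the vertex of degree $s$, and the other vertices are its leaves (for $K_{1,1}$ either vertex may be regarded as the center and the other as the leaf). $tK_1$ denotes $t$ isolated vertices. The graphs in (iv) are obtained by adding one new vertex $u$ to a given graph, as follows: - $K(k,t;\ell)$ ($k\ge 1$, $t\ge 0$, $1\le \ell\le k$): add $u$ to the disjoint union $K_{1,k}\cup tK_1$ and join $u$ to all $t$ isolated vertices and to exactly $\ell$ leaves of $K_{1,k}$, but not to its center. - $K'(k,t;\ell)$ ($k\ge 1$, $t\ge 0$, $0\le \ell\le k$): add $u$ to $K_{1,k}\cup tK_1$ and join $u$ to all $t$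 isolated vertices, to exactly $\ell$ leaves of $K_{1,k}$, and to its center. - $L(t,\ell)$ ($t\ge 0$, $\ell\in\{1,2,3\}$): add $u$ to $K_3\cup tK_1$ and join $u$ to all $t$ isolated vertices and to exactly $\ell$ vertices of $K_3$. - $T(r,k)$ ($r,k\ge 1$): add $u$ to $r$ disjoint copies of $K_{1,k}$ and join $u$ exactly to the $r$ centers. - $S(r,s)$ ($r\ge 1$, $r\le s\le 2r$): add $u$ to $r$ disjoint copies of $K_2$ and join $u$ to them by $s$ edges so that the result is connected; i.e. $u$ is joined to both ends of $s-r$ of the copies of $K_2$ and to exactly one end of each of the other $2r-s$ copies. *)

theory Defs
  imports "HOL-Computational_Algebra.Computational_Algebra" Complex_Main
begin

datatype 'a ugraph = UGraph (verts: "'a set") (edges: "'a set set")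

definition simple_graph :: "'a ugraph \<Rightarrow> bool" where
  "simple_graph G \<longleftrightarrow> finite (verts G) \<and> (\<forall>e \<in> edges G. e \<subseteq> verts G \<and> card e = 2)"

definition connected_graph :: "'a ugraph \<Rightarrow> bool" where
  "connected_graph G \<longleftrightarrow> verts G \<noteq> {} \<and>
     (\<forall>u \<in> verts G. \<forall>v \<in> verts G. (u, v) \<in> {(x, y). {x, y} \<in> edges G}\<^sup>*)"

definition graph_iso :: "'a ugraph \<Rightarrow> 'b ugraph \<Rightarrow> bool"  (infix "\<simeq>\<^sub>G" 50) where
  "G \<simeq>\<^sub>G H \<longleftrightarrow> (\<exists>f. bij_betw f (verts G) (verts H) \<and>
     (\<forall>u \<in> verts G. \<forall>v \<in> verts G. {u, v} \<in> edges G \<longleftrightarrow> {f u, f v} \<in> edges H))"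


definition matchings :: "'a ugraph \<Rightarrow> nat \<Rightarrow> 'a set set set" where
  "matchings G k = {M. M \<subseteq> edges G \<and> finite M \<and> card M = k \<and> pairwise disjnt M}"

definition num_matchings :: "'a ugraph \<Rightarrow> nat \<Rightarrow> nat" where
  "num_matchings G k = card (matchings G k)"

text \<open>
  A graph of order \<open>n\<close> has no \<open>k\<close>-matching with \<open>2 * k > n\<close>, so the sum over all \<open>k\<close> stops
  at \<open>n div 2\<close>, where the subtraction in the exponent is still exact.
  The coefficients are taken to be complex numbers, so that all roots are counted in
  \<open>num_matching_roots\<close> without presupposing that they are real.
\<close>

definition matching_poly :: "'a ugraph \<Rightarrow> complex poly" where
  "matching_poly G =
     (\<Sum>k \<le> card (verts G) div 2.
        monom ((-1) ^ k * of_nat (num_matchings G k)) (card (verts G) - 2 * k))"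

definition num_matching_roots :: "'a ugraph \<Rightarrow> nat" where
  "num_matching_roots G = card {x. poly (matching_poly G) x = 0}"


definition complete_graph :: "nat \<Rightarrow> nat ugraph" where
  "complete_graph n = UGraph {..<n} {{i, j} | i j. i < n \<and> j < n \<and> i \<noteq> j}"

text \<open>\<open>K\<^sub>1\<^sub>,\<^sub>k\<close> has center \<open>0\<close> and leaves \<open>1, \<dots>, k\<close>.\<close>

definition star_graph :: "nat \<Rightarrow> nat ugraph" where
  "star_graph k = UGraph {0..k} {{0, i} | i. i \<in> {1..k}}"

definition isolated_vertices :: "nat \<Rightarrow> nat ugraph" where
  "isolated_vertices t = UGraph {..<t} {}"

definition is_star :: "'a ugraph \<Rightarrow> bool" where
  "is_star G \<longleftrightarrow> (\<exists>s \<ge> 1. G \<simeq>\<^sub>G star_graph s)"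

definition disjoint_union :: "'a ugraph \<Rightarrow> 'b ugraph \<Rightarrow> ('a + 'b) ugraph" where
  "disjoint_union G H = UGraph (verts G <+> verts H)
     ((`) Inl ` edges G \<union> (`) Inr ` edges H)"

definition disjoint_copies :: "nat \<Rightarrow> 'a ugraph \<Rightarrow> (nat \<times> 'a) ugraph" where
  "disjoint_copies r G = UGraph ({..<r} \<times> verts G)
     {Pair i ` e | i e. i < r \<and> e \<in> edges G}"

text \<open>The new vertex is \<open>None\<close>; it is joined exactly to the vertices in \<open>S\<close>.\<close>

definition add_vertex :: "'a ugraph \<Rightarrow> 'a set \<Rightarrow> 'a option ugraph" where
  "add_vertex G S = UGraph (insert None (Some ` verts G))
     ((`) Some ` edges G \<union> {{None, Some v} | v. v \<in> S})"


text \<open>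
  Up to isomorphism it is irrelevant which \<open>l\<close> leaves (or vertices of \<open>K\<^sub>3\<close>, or copies
  and ends of \<open>K\<^sub>2\<close>) the new vertex is joined to; the first ones are taken.
\<close>

definition graph_K :: "nat \<Rightarrow> nat \<Rightarrow> nat \<Rightarrow> (nat + nat) option ugraph" where
  "graph_K k t l = add_vertex (disjoint_union (star_graph k) (isolated_vertices t))
     ({1..l} <+> {..<t})"

definition graph_K' :: "nat \<Rightarrow> nat \<Rightarrow> nat \<Rightarrow> (nat + nat) option ugraph" where
  "graph_K' k t l = add_vertex (disjoint_union (star_graph k) (isolated_vertices t))
     (insert 0 {1..l} <+> {..<t})"

definition graph_L :: "nat \<Rightarrow> nat \<Rightarrow> (nat + nat) option ugraph" where
  "graph_L t l = add_vertex (disjoint_union (complete_graph 3) (isolated_vertices t))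
     ({..<l} <+> {..<t})"

definition graph_T :: "nat \<Rightarrow> nat \<Rightarrow> (nat \<times> nat) option ugraph" where
  "graph_T r k = add_vertex (disjoint_copies r (star_graph k)) ({..<r} \<times> {0})"

text \<open>
  The new vertex is joined to end \<open>0\<close> of every copy of \<open>K\<^sub>2\<close> and to end \<open>1\<close> of the first
  \<open>s - r\<close> copies.
\<close>

definition graph_S :: "nat \<Rightarrow> nat \<Rightarrow> (nat \<times> nat) option ugraph" where
  "graph_S r s = add_vertex (disjoint_copies r (complete_graph 2))
     ({..<r} \<times> {0} \<union> {..<s - r} \<times> {1})"

end

theory Submission
  imports Defs
begin

text \<open>
  Two facts about matching polynomials carry the whole classification.

  First, for a path \<open>p\<close> in \<open>G\<close>, deleting its vertices lowers the multiplicity of every root of the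
  matching polynomial \<open>\<mu>(G)\<close> by at most one. The reason is analytic: expanding along a vertex
  \<open>u\<close> writes \<open>\<mu>(G) / \<mu>(G - u)\<close> as \<open>x - \<Sum>\<^sub>v \<mu>(G - u - v) / \<mu>(G - u)\<close>, and an induction shows that for
  \<open>Im x > 0\<close> the number \<open>- Im (\<mu>(G - u) / \<mu>(G))\<close> is at least \<open>Im x \<cdot> |\<mu>(G - p) / \<mu>(G)|\<^sup>2\<close> for every path
  \<open>p\<close> that starts at \<open>u\<close> (\<open>matching_poly_upper_half_plane\<close>). Hence \<open>Im x \<cdot> |\<mu>(G - p)| \<le> |\<mu>(G)|\<close> on the
  upper half plane, and letting \<open>x\<close> tend vertically to a root compares the multiplicities. If \<open>D\<close> is
  the product of \<open>x - \<theta>\<close> over the distinct roots \<open>\<theta>\<close>, this says that \<open>\<mu>(G)\<close> divides \<open>\<mu>(G - p) \<cdot> D\<close>.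
  Degrees then give Godsil's bound: a graph with \<open>z\<close> distinct matching roots has no path with more
  than \<open>z\<close> vertices (\<open>path_length_le_num_matching_roots\<close>).

  Second, if \<open>p\<close> has exactly \<open>z\<close> vertices, the degrees agree and \<open>\<mu>(G) = \<mu>(G - p) \<cdot> D\<close>
  (\<open>matching_poly_extremal_path\<close>). Only two coefficients of this identity are needed. The order at
  \<open>0\<close> relates the matching numbers of \<open>G\<close> and \<open>G - p\<close>, and even forces a perfect matching of \<open>G\<close> if \<open>z\<close> is even
  (\<open>extremal_path_matching\<close>). The second leading coefficient shows that \<open>G - p\<close> has the same number
  of edges for all such paths \<open>p\<close> (\<open>extremal_path_edges\<close>).

  What remains is combinatorics of connected graphs without long paths. Without a path on four
  vertices a graph is a star or has at most three vertices. Without a path on five vertices, but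
  with one on four, the two inner vertices of that path cover all edges of a graph with more than four
  vertices. This settles two, three and four roots. With five roots and more than five
  vertices, such a cover leads to the families \<open>K\<close> and \<open>K'\<close>; otherwise let \<open>p\<close> be a path on five vertices. If \<open>G - p\<close> has no edges, the matching number of \<open>G\<close> is at most two, and
  \<open>G\<close> either has a vertex cover of size two as well or is a triangle with pendant
  vertices at one further vertex (family \<open>L\<close>). If \<open>G - p\<close> has an edge, three arms of length two meet in the
  middle vertex \<open>u\<close> of \<open>p\<close>, and since there is no path on six vertices, \<open>G - u\<close> is a union of stars
  (locale \<open>star_cone\<close>). Comparing edge counts for two paths makes all nontrivial stars equally
  large, the matching number excludes trivial ones, and \<open>G\<close> is in family \<open>T\<close> or \<open>S\<close>.
\<close>

section \<open>The matching polynomial as a sum over matchings\<close>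

definition all_matchings :: "'a ugraph \<Rightarrow> 'a set set set" where
  "all_matchings G = {M. M \<subseteq> edges G \<and> pairwise disjnt M}"

definition remove_verts :: "'a ugraph \<Rightarrow> 'a set \<Rightarrow> 'a ugraph" where
  "remove_verts G X = UGraph (verts G - X) {e \<in> edges G. e \<inter> X = {}}"

lemma verts_remove_verts [simp]: "verts (remove_verts G X) = verts G - X"
  by (simp add: remove_verts_def)

lemma edges_remove_verts [simp]: "edges (remove_verts G X) = {e \<in> edges G. e \<inter> X = {}}"
  by (simp add: remove_verts_def)

lemma remove_verts_remove_verts [simp]:
  "remove_verts (remove_verts G X) Y = remove_verts G (X \<union> Y)"
  by (auto simp: remove_verts_def)

lemma simple_graph_remove_verts [simp]: "simple_graph G \<Longrightarrow> simple_graph (remove_verts G X)"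
  by (auto simp: simple_graph_def)

lemma finite_verts: "simple_graph G \<Longrightarrow> finite (verts G)"
  by (simp add: simple_graph_def)

lemma finite_edges: "simple_graph G \<Longrightarrow> finite (edges G)"
  by (rule finite_subset[of _ "Pow (verts G)"]) (auto simp: simple_graph_def)

lemma edge_in_verts: "simple_graph G \<Longrightarrow> {u, v} \<in> edges G \<Longrightarrow> u \<in> verts G \<and> v \<in> verts G"
  by (auto simp: simple_graph_def)

lemma edge_neq: "simple_graph G \<Longrightarrow> {u, v} \<in> edges G \<Longrightarrow> u \<noteq> v"
  by (auto simp: simple_graph_def)

lemma no_loop: "simple_graph G \<Longrightarrow> {u} \<notin> edges G"
  by (auto simp: simple_graph_def)

lemma edgeE:
  assumes "simple_graph G" "e \<in> edges G"
  obtains u v where "e = {u, v}" "u \<noteq> v" "u \<in> verts G" "v \<in> verts G"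
  using assms by (auto simp: simple_graph_def card_2_iff)

lemma edge_containingE:
  assumes "simple_graph G" "e \<in> edges G" "u \<in> e"
  obtains v where "e = {u, v}" "u \<noteq> v" "v \<in> verts G"
  using assms by (elim edgeE) (auto simp: insert_commute)

lemma finite_all_matchings: "simple_graph G \<Longrightarrow> finite (all_matchings G)"
  by (rule finite_subset[of _ "Pow (edges G)"]) (auto simp: all_matchings_def finite_edges)

lemma finite_matching: "simple_graph G \<Longrightarrow> M \<in> all_matchings G \<Longrightarrow> finite M"
  by (auto simp: all_matchings_def intro: finite_subset[OF _ finite_edges])

lemma empty_in_all_matchings [simp]: "{} \<in> all_matchings G"
  by (auto simp: all_matchings_def)

lemma matching_card_le:
  assumes G: "simple_graph G" and M: "M \<in> all_matchings G"
  shows "2 * card M \<le> card (verts G)"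
proof -
  have sub: "M \<subseteq> edges G" and dis: "pairwise disjnt M" using M by (auto simp: all_matchings_def)
  have c2: "card e = 2" "finite e" if "e \<in> M" for e
    using G sub that by (auto simp: simple_graph_def intro: rev_finite_subset)
  have "card (\<Union>M) = sum card M" by (rule card_Union_disjoint) (use dis c2 in auto)
  also have "\<dots> = 2 * card M" using c2 by simp
  finally have "2 * card M = card (\<Union>M)" by simp
  also have "\<dots> \<le> card (verts G)"
    by (rule card_mono) (use G sub in \<open>auto simp: simple_graph_def\<close>)
  finally show ?thesis .
qed

text \<open>
  Disjoint edges need distinct vertices of a vertex cover.
\<close>

lemma matching_card_le_cover:
  assumes M: "M \<in> all_matchings G" and K: "finite K" "\<And>e. e \<in> edges G \<Longrightarrow> e \<inter> K \<noteq> {}"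
  shows "card M \<le> card K"
proof -
  have sub: "M \<subseteq> edges G" and dis: "pairwise disjnt M" using M by (auto simp: all_matchings_def)
  have "\<forall>e\<in>M. \<exists>a. a \<in> K \<and> a \<in> e" using K(2) sub by blast
  then obtain f where f: "\<And>e. e \<in> M \<Longrightarrow> f e \<in> K \<and> f e \<in> e" by metis
  have "inj_on f M"
  proof (rule inj_onI)
    fix e e' assume e: "e \<in> M" "e' \<in> M" "f e = f e'"
    then have "\<not> disjnt e e'" using f[OF e(1)] f[OF e(2)] by (auto simp: disjnt_def)
    then show "e = e'" using dis e(1,2) by (auto simp: pairwise_def)
  qed
  then show ?thesis by (rule card_inj_on_le) (use f K(1) in auto)
qed

lemma matchings_eq: "simple_graph G \<Longrightarrow> matchings G k = {M \<in> all_matchings G. card M = k}"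
  by (auto simp: matchings_def finite_matching) (auto simp: all_matchings_def)

text \<open>
  Summing over matchings instead of over their sizes turns the vertex expansion below into a
  partition of the set of matchings.
\<close>

lemma matching_poly_eq_sum:
  assumes G: "simple_graph G"
  shows "matching_poly G =
    (\<Sum>M\<in>all_matchings G. monom ((-1) ^ card M) (card (verts G) - 2 * card M))"
proof -
  let ?n = "card (verts G)"
  let ?h = "\<lambda>M. monom ((-1 :: complex) ^ card M) (?n - 2 * card M)"
  have "(\<Sum>M\<in>all_matchings G. ?h M) =
      (\<Sum>k\<le>?n div 2. sum ?h {M. M \<in> all_matchings G \<and> card M = k})"
    by (rule sum.group[symmetric])
      (use finite_all_matchings[OF G] matching_card_le[OF G] in \<open>force+\<close>)
  also have "\<dots> = (\<Sum>k\<le>?n div 2. monom ((-1) ^ k * of_nat (num_matchings G k)) (?n - 2 * k))"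
  proof (rule sum.cong[OF refl])
    fix k
    have "sum ?h {M. M \<in> all_matchings G \<and> card M = k} =
        (\<Sum>M\<in>matchings G k. monom ((-1) ^ k) (?n - 2 * k))"
      by (rule sum.cong) (auto simp: matchings_eq[OF G])
    also have "\<dots> = of_nat (num_matchings G k) * monom ((-1) ^ k) (?n - 2 * k)"
      by (simp add: num_matchings_def)
    also have "\<dots> = monom ((-1) ^ k * of_nat (num_matchings G k)) (?n - 2 * k)"
      by (simp add: of_nat_poly smult_monom mult.commute)
    finally show "sum ?h {M. M \<in> all_matchings G \<and> card M = k} =
      monom ((-1) ^ k * of_nat (num_matchings G k)) (?n - 2 * k)" .
  qed
  finally show ?thesis by (simp add: matching_poly_def)
qed

lemma poly_matching_poly:
  assumes "simple_graph G"
  shows "poly (matching_poly G) x =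
    (\<Sum>M\<in>all_matchings G. (-1) ^ card M * x ^ (card (verts G) - 2 * card M))"
  by (simp add: matching_poly_eq_sum[OF assms] poly_sum poly_monom)

lemma coeff_matching_poly:
  assumes G: "simple_graph G" and k: "2 * k \<le> card (verts G)"
  shows "coeff (matching_poly G) (card (verts G) - 2 * k) = (-1) ^ k * of_nat (num_matchings G k)"
proof -
  have "coeff (matching_poly G) (card (verts G) - 2 * k) =
      (\<Sum>j\<le>card (verts G) div 2. if j = k then (-1) ^ k * of_nat (num_matchings G k) else 0)"
    unfolding matching_poly_def coeff_sum
    by (rule sum.cong) (use k in \<open>auto simp: coeff_monom\<close>)
  then show ?thesis using k by auto
qed

lemma num_matchings_0 [simp]: "num_matchings G 0 = 1"
proof -
  have "matchings G 0 = {{}}" by (auto simp: matchings_def)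
  then show ?thesis by (simp add: num_matchings_def)
qed

lemma num_matchings_1:
  assumes "simple_graph G"
  shows "num_matchings G 1 = card (edges G)"
proof -
  have "matchings G 1 = (\<lambda>e. {e}) ` edges G" by (auto simp: matchings_def card_1_singleton_iff)
  then show ?thesis by (simp add: num_matchings_def card_image)
qed

lemma degree_matching_poly:
  assumes G: "simple_graph G"
  shows "degree (matching_poly G) = card (verts G)" "lead_coeff (matching_poly G) = 1"
    "matching_poly G \<noteq> 0"
proof -
  have 1: "coeff (matching_poly G) (card (verts G)) = 1" using coeff_matching_poly[OF G, of 0] by simp
  have "degree (matching_poly G) \<le> card (verts G)"
    unfolding matching_poly_def
    by (intro degree_sum_le) (auto intro: order_trans[OF degree_monom_le])
  with 1 show 2: "degree (matching_poly G) = card (verts G)"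
    by (intro antisym le_degree) auto
  show "lead_coeff (matching_poly G) = 1" "matching_poly G \<noteq> 0" using 1 2 by auto
qed

text \<open>
  The lowest nonzero coefficient of the matching polynomial belongs to the largest matchings, so the
  multiplicity of the root \<open>0\<close> is the number of vertices that a maximum matching misses.
\<close>

lemma maximum_matching:
  assumes G: "simple_graph G"
  obtains M where "M \<in> all_matchings G" "\<And>M'. M' \<in> all_matchings G \<Longrightarrow> card M' \<le> card M"
    "monom 1 (card (verts G) - 2 * card M) dvd matching_poly G"
    "order 0 (matching_poly G) = card (verts G) - 2 * card M"
proof -
  let ?n = "card (verts G)"
  have fin: "finite (card ` all_matchings G)" "card ` all_matchings G \<noteq> {}"
    using finite_all_matchings[OF G] empty_in_all_matchings[of G] by blast+
  obtain M where M: "M \<in> all_matchings G" "card M = Max (card ` all_matchings G)"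
    using Max_in[OF fin] by (metis imageE)
  have max: "card M' \<le> card M" if "M' \<in> all_matchings G" for M'
    using Max_ge[OF fin(1)] that M(2) by simp
  have le: "2 * card M \<le> ?n" by (rule matching_card_le[OF G M(1)])
  have "num_matchings G (card M) \<noteq> 0"
    using M(1) finite_all_matchings[OF G] by (auto simp: num_matchings_def matchings_eq[OF G])
  then have nz: "coeff (matching_poly G) (?n - 2 * card M) \<noteq> 0"
    by (simp add: coeff_matching_poly[OF G le])
  have zero: "coeff (matching_poly G) i = 0" if "i < ?n - 2 * card M" for i
    unfolding matching_poly_eq_sum[OF G] coeff_sum
    by (rule sum.neutral) (use that max in \<open>fastforce simp: coeff_monom\<close>)
  have dvd: "monom 1 j dvd matching_poly G \<longleftrightarrow> j \<le> ?n - 2 * card M" for j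
    unfolding monom_1_dvd_iff' using nz zero by (metis linorder_not_less order.strict_trans1 )
  have "order 0 (matching_poly G) = ?n - 2 * card M"
    using dvd monom_1_dvd_iff[OF degree_matching_poly(3)[OF G]] by (metis order_refl antisym)
  with M max dvd show ?thesis by (intro that[of M]) auto
qed

lemma num_matching_roots_le_verts:
  assumes G: "simple_graph G"
  shows "num_matching_roots G \<le> card (verts G)"
  using card_poly_roots_bound[OF degree_matching_poly(3)[OF G]]
  by (simp add: num_matching_roots_def degree_matching_poly(1)[OF G])

text \<open>
  After a power of \<open>x\<close> is split off, the degree that remains is twice the matching number.
\<close>

lemma num_matching_roots_le_matching:
  assumes G: "simple_graph G" and k: "\<And>M. M \<in> all_matchings G \<Longrightarrow> card M \<le> k"
  shows "num_matching_roots G \<le> 2 * k + 1"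
proof -
  let ?p = "matching_poly G"
  obtain M where M: "M \<in> all_matchings G"
    and dvd: "monom 1 (card (verts G) - 2 * card M) dvd ?p"
    by (rule maximum_matching[OF G])
  obtain q where q: "?p = monom 1 (card (verts G) - 2 * card M) * q"
    using dvd by (auto elim: dvdE)
  have nz: "q \<noteq> 0" using q degree_matching_poly(3)[OF G] by auto
  have "card (verts G) = card (verts G) - 2 * card M + degree q"
    using degree_matching_poly(1)[OF G] nz by (simp add: q degree_mult_eq degree_monom_eq monom_eq_0_iff)
  then have dq: "degree q = 2 * card M" using matching_card_le[OF G M] by simp
  have "{x. poly ?p x = 0} \<subseteq> insert 0 {x. poly q x = 0}" by (auto simp: q poly_monom)
  then have "num_matching_roots G \<le> card (insert 0 {x. poly q x = 0})"
    unfolding num_matching_roots_def by (intro card_mono) (auto simp: poly_roots_finite nz)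
  also have "\<dots> \<le> Suc (card {x. poly q x = 0})" by (rule card_insert_le_m1) auto
  also have "card {x. poly q x = 0} \<le> 2 * k"
    using card_poly_roots_bound[OF nz] dq k[OF M] by linarith
  finally show ?thesis by simp
qed

text \<open>
  A matching of \<open>G\<close> either avoids \<open>u\<close> or consists of one edge \<open>{u, v}\<close> and a matching of
  \<open>G - u - v\<close>; the edge contributes the sign.
\<close>

lemma matching_poly_vertex:
  assumes G: "simple_graph G" and u: "u \<in> verts G"
  shows "poly (matching_poly G) x = x * poly (matching_poly (remove_verts G {u})) x
    - (\<Sum>v\<in>{v. {u, v} \<in> edges G}. poly (matching_poly (remove_verts G {u, v})) x)"
proof -
  let ?n = "card (verts G)"
  let ?N = "{v. {u, v} \<in> edges G}"
  let ?h = "\<lambda>M. (-1 :: complex) ^ card M * x ^ (?n - 2 * card M)"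
  let ?A = "all_matchings (remove_verts G {u})"
  let ?B = "\<lambda>v. insert {u, v} ` all_matchings (remove_verts G {u, v})"
  have finN: "finite ?N"
    by (rule finite_subset[OF _ finite_verts[OF G]]) (auto dest: edge_in_verts[OF G])
  have finA: "finite (all_matchings (remove_verts G X))" for X
    by (intro finite_all_matchings simple_graph_remove_verts G)
  have notin: "{u, v} \<notin> M" if "M \<in> all_matchings (remove_verts G {u, w})" for M v w
    using that by (auto simp: all_matchings_def)
  have notinA: "{u, v} \<notin> M" if "M \<in> ?A" for M v
    using that by (auto simp: all_matchings_def)
  have split: "all_matchings G = ?A \<union> (\<Union>v\<in>?N. ?B v)"
  proof (intro equalityI subsetI)
    fix M assume M: "M \<in> all_matchings G"
    show "M \<in> ?A \<union> (\<Union>v\<in>?N. ?B v)"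
    proof (cases "\<exists>e\<in>M. u \<in> e")
      case False
      then show ?thesis using M by (auto simp: all_matchings_def)
    next
      case True
      then obtain e where e: "e \<in> M" "u \<in> e" by blast
      with M have "e \<in> edges G" by (auto simp: all_matchings_def)
      then obtain v where v: "e = {u, v}" using edge_containingE[OF G _ e(2)] by blast
      have "M - {e} \<in> all_matchings (remove_verts G {u, v})"
        using M e v by (fastforce simp: all_matchings_def pairwise_def disjnt_def)
      then have "M \<in> ?B v" using e v by (intro image_eqI[of _ _ "M - {e}"]) auto
      then show ?thesis using \<open>e \<in> edges G\<close> v by blast
    qed
  next
    fix M assume "M \<in> ?A \<union> (\<Union>v\<in>?N. ?B v)"
    then show "M \<in> all_matchings G"
      by (auto simp: all_matchings_def pairwise_insert disjnt_def pairwise_def)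
  qed
  have "poly (matching_poly G) x = sum ?h (?A \<union> (\<Union>v\<in>?N. ?B v))"
    by (simp only: poly_matching_poly[OF G] split)
  also have "\<dots> = sum ?h ?A + sum ?h (\<Union>v\<in>?N. ?B v)"
    by (rule sum.union_disjoint) (use finN finA notinA in \<open>auto\<close>)
  also have "sum ?h (\<Union>v\<in>?N. ?B v) = (\<Sum>v\<in>?N. sum ?h (?B v))"
  proof (rule sum.UNION_disjoint[OF finN])
    show "\<forall>v\<in>?N. \<forall>w\<in>?N. v \<noteq> w \<longrightarrow> ?B v \<inter> ?B w = {}"
    proof (intro ballI impI equals0I)
      fix v w M assume vw: "v \<noteq> w" and "M \<in> ?B v \<inter> ?B w"
      then obtain M' where "M = insert {u, w} M'" "M' \<in> all_matchings (remove_verts G {u, w})"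
        "{u, v} \<in> M" by auto
      with notin[of M' w v] vw show False by (auto simp: doubleton_eq_iff)
    qed
  qed (use finA in auto)
  also have "sum ?h ?A = x * poly (matching_poly (remove_verts G {u})) x"
  proof -
    have "?h M = x * ((-1) ^ card M * x ^ (card (verts (remove_verts G {u})) - 2 * card M))"
      if M: "M \<in> ?A" for M
    proof -
      have n: "?n = Suc (card (verts (remove_verts G {u})))"
        using u finite_verts[OF G] by (simp add: card_Suc_Diff1 del: card_Diff_insert)
      have "?n - 2 * card M = Suc (card (verts (remove_verts G {u})) - 2 * card M)"
        unfolding n using matching_card_le[OF simple_graph_remove_verts[OF G] M] by (simp add: Suc_diff_le)
      then show ?thesis by simp
    qed
    then show ?thesis
      by (simp only: poly_matching_poly simple_graph_remove_verts G sum_distrib_left cong: sum.cong)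
  qed
  also have "(\<Sum>v\<in>?N. sum ?h (?B v)) =
    (\<Sum>v\<in>?N. - poly (matching_poly (remove_verts G {u, v})) x)"
  proof (rule sum.cong[OF refl])
    fix v assume "v \<in> ?N"
    then have v: "v \<in> verts G" "u \<noteq> v" using edge_in_verts[OF G] edge_neq[OF G] by auto
    have inj: "inj_on (insert {u, v}) (all_matchings (remove_verts G {u, v}))"
      using notin by (intro inj_onI) (metis insert_ident)
    have n: "card (verts (remove_verts G {u, v})) = ?n - 2"
      using u v finite_verts[OF G] by (simp add: card_Diff_subset)
    have "sum ?h (?B v) = (\<Sum>M\<in>all_matchings (remove_verts G {u, v}). ?h (insert {u, v} M))"
      by (simp add: sum.reindex[OF inj])
    also have "\<dots> = (\<Sum>M\<in>all_matchings (remove_verts G {u, v}). - ((-1) ^ card M * x ^ (?n - 2 - 2 * card M)))"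
    proof (rule sum.cong[OF refl])
      fix M assume M: "M \<in> all_matchings (remove_verts G {u, v})"
      have "card (insert {u, v} M) = Suc (card M)"
        using notin[OF M] finite_matching[OF simple_graph_remove_verts[OF G] M] by simp
      then show "?h (insert {u, v} M) = - ((-1) ^ card M * x ^ (?n - 2 - 2 * card M))" by simp
    qed
    finally show "sum ?h (?B v) = - poly (matching_poly (remove_verts G {u, v})) x"
      unfolding poly_matching_poly[OF simple_graph_remove_verts[OF G]] n by (simp only: sum_negf)
  qed
  finally show ?thesis by (simp add: sum_negf)
qed

section \<open>Paths and roots\<close>

definition is_path :: "'a ugraph \<Rightarrow> 'a list \<Rightarrow> bool" where
  "is_path G xs \<longleftrightarrow> distinct xs \<and> set xs \<subseteq> verts G \<and> successively (\<lambda>x y. {x, y} \<in> edges G) xs"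

lemma is_path_remove_first:
  assumes "is_path G (u # v # ps)"
  shows "u \<in> verts G" "{u, v} \<in> edges G" "is_path (remove_verts G {u}) (v # ps)"
proof -
  show "u \<in> verts G" "{u, v} \<in> edges G" using assms by (auto simp: is_path_def)
  have "successively (\<lambda>x y. {x, y} \<in> edges G \<and> {x, y} \<inter> {u} = {}) (v # ps)"
    by (rule successively_mono[of "\<lambda>x y. {x, y} \<in> edges G"]) (use assms in \<open>auto simp: is_path_def\<close>)
  then show "is_path (remove_verts G {u}) (v # ps)"
    using assms by (auto simp: is_path_def)
qed

lemma Im_inverse_neg: "Im (inverse w) = - Im w * (norm (inverse w))\<^sup>2"
  by (simp add: norm_inverse power_inverse cmod_power2 divide_inverse)

text \<open>
  Write \<open>\<mu>(G) = \<mu>(G - u) \<cdot> w\<close> with \<open>w = x - \<Sum>\<^sub>v \<mu>(G - u - v) / \<mu>(G - u)\<close>. By induction every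
  summand has nonpositive imaginary part, so \<open>Im w \<ge> Im x\<close> and \<open>\<mu>(G)\<close> does not vanish. Moreover the
  summand of the second vertex of a path already has an imaginary part as large as the claim for the
  rest of the path demands, and multiplying by \<open>|1 / w|\<^sup>2\<close> transports this bound from \<open>G - u\<close> to
  \<open>G\<close>. This strengthens the Heilmann-Lieb theorem by a quantitative term for each path.
\<close>

lemma matching_poly_upper_half_plane:
  assumes "simple_graph G" and "Im x > 0"
  shows "poly (matching_poly G) x \<noteq> 0 \<and>
    (\<forall>u ps. is_path G (u # ps) \<longrightarrow>
      Im x * (norm (poly (matching_poly (remove_verts G (set (u # ps)))) x / poly (matching_poly G) x))\<^sup>2
      \<le> - Im (poly (matching_poly (remove_verts G {u})) x / poly (matching_poly G) x))"
  using assms(1)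
proof (induction "card (verts G)" arbitrary: G rule: less_induct)
  case less
  note G = less.prems
  let ?P = "\<lambda>X. poly (matching_poly (remove_verts G X)) x"
  let ?\<mu> = "poly (matching_poly G) x"
  let ?N = "\<lambda>u. {v. {u, v} \<in> edges G}"
  define w where "w u = x - (\<Sum>v\<in>?N u. ?P {u, v} / ?P {u})" for u
  have finN: "finite (?N u)" for u
    by (rule finite_subset[OF _ finite_verts[OF G]]) (auto dest: edge_in_verts[OF G])
  have smaller: "card (verts (remove_verts G {u})) < card (verts G)" if "u \<in> verts G" for u
    using that finite_verts[OF G] by (intro psubset_card_mono) auto
  have nz: "?P {u} \<noteq> 0" if "u \<in> verts G" for u
    using less.hyps[OF smaller[OF that]] G by simp
  have IH: "Im x * (norm (?P (set (u # v # ps)) / ?P {u}))\<^sup>2 \<le> - Im (?P {u, v} / ?P {u})"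
    if "u \<in> verts G" "is_path (remove_verts G {u}) (v # ps)" for u v ps
    using less.hyps[OF smaller[OF that(1)] simple_graph_remove_verts[OF G],
      THEN conjunct2, rule_format, OF that(2)] by (simp add: insert_commute)
  have IH0: "Im (?P {u, v} / ?P {u}) \<le> 0" if "u \<in> verts G" "v \<in> ?N u" for u v
  proof -
    have "is_path (remove_verts G {u}) [v]"
      using that edge_in_verts[OF G] edge_neq[OF G] by (auto simp: is_path_def)
    from IH[OF that(1) this] have "Im x * (norm (?P (set [u, v]) / ?P {u}))\<^sup>2 \<le> - Im (?P {u, v} / ?P {u})" .
    moreover have "0 \<le> Im x * (norm (?P (set [u, v]) / ?P {u}))\<^sup>2" using assms(2) by simp
    ultimately show ?thesis by linarith
  qed
  have \<mu>: "?\<mu> = ?P {u} * w u" if "u \<in> verts G" for u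
    unfolding matching_poly_vertex[OF G that] w_def
    using nz[OF that] by (simp add: right_diff_distrib sum_distrib_left)
  have Im_w: "Im (w u) = Im x - (\<Sum>v\<in>?N u. Im (?P {u, v} / ?P {u}))" for u
    by (simp add: w_def)
  have w_pos: "Im x \<le> Im (w u)" if "u \<in> verts G" for u
    using sum_nonpos[of "?N u" "\<lambda>v. Im (?P {u, v} / ?P {u})"] IH0[OF that] by (simp add: Im_w)
  have w_nz: "w u \<noteq> 0" if "u \<in> verts G" for u
    using w_pos[OF that] assms(2) by auto
  have inv: "?P {u} / ?\<mu> = inverse (w u)" if "u \<in> verts G" for u
    using \<mu>[OF that] nz[OF that] by (simp add: divide_simps)
  have "?\<mu> \<noteq> 0"
  proof (cases "verts G = {}")
    case True
    then have "edges G = {}" using G by (auto simp: simple_graph_def)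
    then have "all_matchings G = {{}}" by (auto simp: all_matchings_def)
    then show ?thesis using True by (simp add: poly_matching_poly[OF G])
  next
    case False
    then show ?thesis using \<mu> nz w_nz by (metis ex_in_conv mult_eq_0_iff)
  qed
  moreover have "Im x * (norm (?P (set (u # ps)) / ?\<mu>))\<^sup>2 \<le> - Im (?P {u} / ?\<mu>)"
    if p: "is_path G (u # ps)" for u ps
  proof -
    have u: "u \<in> verts G" using p by (auto simp: is_path_def)
    have "Im x * (norm (?P (set (u # ps)) / ?P {u}))\<^sup>2 \<le> Im (w u)"
    proof (cases ps)
      case Nil
      then show ?thesis using w_pos[OF u] nz[OF u] by simp
    next
      case (Cons v qs)
      note q = is_path_remove_first[OF p[unfolded Cons]]
      have "- Im (?P {u, v} / ?P {u}) \<le> (\<Sum>v\<in>?N u. - Im (?P {u, v} / ?P {u}))"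
        by (rule member_le_sum) (use IH0[OF u] q finN in auto)
      then show ?thesis using IH[OF u q(3)] assms(2) unfolding Im_w Cons by (simp add: sum_negf)
    qed
    then have "Im x * (norm (?P (set (u # ps)) / ?P {u}))\<^sup>2 * (norm (inverse (w u)))\<^sup>2
        \<le> Im (w u) * (norm (inverse (w u)))\<^sup>2"
      by (rule mult_right_mono) simp
    also have "Im (w u) * (norm (inverse (w u)))\<^sup>2 = - Im (?P {u} / ?\<mu>)"
      unfolding inv[OF u] Im_inverse_neg by simp
    also have "Im x * (norm (?P (set (u # ps)) / ?P {u}))\<^sup>2 * (norm (inverse (w u)))\<^sup>2
      = Im x * (norm (?P (set (u # ps)) / ?\<mu>))\<^sup>2"
      unfolding \<mu>[OF u] by (simp add: norm_divide norm_mult norm_inverse power_mult_distrib divide_simps)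
    finally show ?thesis .
  qed
  ultimately show ?case by simp
qed

text \<open>
  With \<open>f = \<mu>(G - u) / \<mu>(G)\<close> for the first vertex \<open>u\<close> and \<open>r = \<mu>(G - p) / \<mu>(G)\<close>, the previous
  lemma applied to the one-vertex path gives \<open>Im x \<cdot> |f| \<le> 1\<close>, and applied to \<open>p\<close> it gives
  \<open>Im x \<cdot> |r|\<^sup>2 \<le> |f|\<close>.
\<close>

lemma norm_matching_poly_path:
  assumes G: "simple_graph G" and p: "is_path G p" "p \<noteq> []" and x: "Im x > 0"
  shows "Im x * norm (poly (matching_poly (remove_verts G (set p))) x) \<le> norm (poly (matching_poly G) x)"
proof -
  obtain u ps where ups: "p = u # ps" using p(2) by (cases p) auto
  let ?\<mu> = "poly (matching_poly G) x"
  define f where "f = poly (matching_poly (remove_verts G {u})) x / ?\<mu>"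
  define r where "r = poly (matching_poly (remove_verts G (set p))) x / ?\<mu>"
  note * = matching_poly_upper_half_plane[OF G x]
  have "is_path G [u]" using p by (auto simp: is_path_def ups)
  from *[THEN conjunct2, rule_format, OF this] have 1: "Im x * (norm f)\<^sup>2 \<le> - Im f"
    by (simp add: f_def)
  have 2: "Im x * (norm r)\<^sup>2 \<le> - Im f" using * p(1) by (simp add: f_def r_def ups)
  have 3: "- Im f \<le> norm f" using abs_Im_le_cmod[of f] by linarith
  have 4: "Im x * norm f \<le> 1"
  proof (cases "norm f = 0")
    case False
    have "(Im x * norm f) * norm f \<le> 1 * norm f" using 1 3 by (simp add: power2_eq_square)
    then show ?thesis using False by (simp only: mult_le_cancel_right) auto
  qed auto
  have "(Im x * norm r)\<^sup>2 \<le> Im x * norm f"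
    using mult_left_mono[OF order_trans[OF 2 3], of "Im x"] x by (simp add: power2_eq_square mult_ac)
  with 4 have "(Im x * norm r)\<^sup>2 \<le> 1\<^sup>2" by simp
  then have "Im x * norm r \<le> 1" by (rule power2_le_imp_le) simp
  then show ?thesis using * by (auto simp: r_def norm_divide divide_simps)
qed

lemma poly_matching_poly_cnj:
  "simple_graph G \<Longrightarrow> poly (matching_poly G) (cnj x) = cnj (poly (matching_poly G) x)"
  by (simp add: poly_matching_poly)

lemma matching_roots_real:
  assumes G: "simple_graph G" and root: "poly (matching_poly G) x = 0"
  shows "Im x = 0"
proof (rule ccontr)
  assume "Im x \<noteq> 0"
  then have "Im x > 0 \<or> Im (cnj x) > 0" by auto
  then show False
    using matching_poly_upper_half_plane[OF G] root poly_matching_poly_cnj[OF G, of x]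
    by (metis complex_cnj_zero)
qed

text \<open>
  Near \<open>a\<close> the two sides decay like \<open>y\<close> to the power \<open>1 + order a q\<close> and \<open>order a p\<close>.
\<close>

lemma order_le_Suc_of_norm_le:
  fixes p q :: "complex poly"
  assumes q: "q \<noteq> 0" and le: "\<And>y. y > 0 \<Longrightarrow>
    y * norm (poly q (a + \<i> * of_real y)) \<le> norm (poly p (a + \<i> * of_real y))"
  shows "order a p \<le> Suc (order a q)"
proof (cases "p = 0")
  case True
  have "poly q (a + \<i> * of_real y) = 0" if "y > 0" for y
    using le[OF that] that True by (simp add: mult_le_0_iff)
  then have "(\<lambda>y. a + \<i> * of_real y) ` {0<..} \<subseteq> {z. poly q z = 0}" by auto
  moreover have "infinite ((\<lambda>y::real. a + \<i> * of_real y) ` {0<..})"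
    by (subst finite_image_iff) (auto intro: inj_onI simp: infinite_Ioi)
  ultimately show ?thesis using poly_roots_finite[OF q] finite_subset by blast
next
  case False
  show ?thesis
  proof (rule ccontr)
    assume "\<not> order a p \<le> Suc (order a q)"
    \<comment> \<open>the surplus factor \<open>y ^ Suc j\<close> would force the cofactor of \<open>q\<close> to vanish at \<open>a\<close>\<close>
    then obtain j where j: "order a p = Suc (order a q) + Suc j"
      by (metis add_Suc_right less_iff_Suc_add not_le)
    obtain g where g: "p = [:- a, 1:] ^ order a p * g" using order_1[of a p] by (auto elim: dvdE)
    obtain h where h: "q = [:- a, 1:] ^ order a q * h" "poly h a \<noteq> 0"
      using order_decomp[OF q, of a] by (auto simp: poly_eq_0_iff_dvd)
    have split: "norm (poly p (a + \<i> * of_real y)) =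
          y ^ (Suc (order a q) + Suc j) * norm (poly g (a + \<i> * of_real y))"
        "norm (poly q (a + \<i> * of_real y)) = y ^ order a q * norm (poly h (a + \<i> * of_real y))"
      if y: "y > 0" for y
      using arg_cong[OF g, of "\<lambda>r. norm (poly r (a + \<i> * of_real y))"]
        arg_cong[OF h(1), of "\<lambda>r. norm (poly r (a + \<i> * of_real y))"] y
      by (simp_all only: j poly_mult poly_power norm_mult norm_power) (simp_all add: norm_mult)
    have bound: "norm (poly h (a + \<i> * of_real y)) \<le> y ^ Suc j * norm (poly g (a + \<i> * of_real y))"
      if y: "y > 0" for y
    proof -
      have "y ^ Suc (order a q) * norm (poly h (a + \<i> * of_real y)) \<le>
        y ^ Suc (order a q) * (y ^ Suc j * norm (poly g (a + \<i> * of_real y)))"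
        using le[OF y] by (simp add: split[OF y] power_add mult_ac)
      then show ?thesis using y by (simp only: mult_le_cancel_left) auto
    qed
    have lim: "((\<lambda>y. poly r (a + \<i> * of_real y)) \<longlongrightarrow> poly r a) (at_right 0)" for r :: "complex poly"
    proof -
      have "isCont (\<lambda>y::real. poly r (a + \<i> * of_real y)) 0" by (intro continuous_intros)
      then show ?thesis by (auto simp: isCont_def intro: tendsto_mono[OF at_le])
    qed
    have "norm (poly h a) \<le> 0 ^ Suc j * norm (poly g a)"
    proof (rule tendsto_le[of "at_right (0::real)"])
      show "((\<lambda>y. norm (poly h (a + \<i> * of_real y))) \<longlongrightarrow> norm (poly h a)) (at_right 0)"
        by (intro tendsto_intros lim)
      show "((\<lambda>y. y ^ Suc j * norm (poly g (a + \<i> * of_real y))) \<longlongrightarrow> 0 ^ Suc j * norm (poly g a)) (at_right 0)"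
        by (intro tendsto_intros lim)
      show "\<forall>\<^sub>F y in at_right 0. norm (poly h (a + \<i> * of_real y)) \<le> y ^ Suc j * norm (poly g (a + \<i> * of_real y))"
        using bound by (auto simp: eventually_at_right_less intro: eventually_mono[OF eventually_at_right_less])
    qed simp
    with h(2) show False by simp
  qed
qed

text \<open>
  Roots are real, so the vertical line above a root lies in the half plane where the norm estimate
  holds.
\<close>

lemma order_matching_poly_path:
  assumes G: "simple_graph G" and p: "is_path G p" "p \<noteq> []"
  shows "order a (matching_poly G) \<le> Suc (order a (matching_poly (remove_verts G (set p))))"
proof (cases "poly (matching_poly G) a = 0")
  case True
  with matching_roots_real[OF G] have "Im a = 0" by simp
  then show ?thesis
    using norm_matching_poly_path[OF G p, of "a + \<i> * of_real y" for y]
    by (intro order_le_Suc_of_norm_le degree_matching_poly(3) simple_graph_remove_verts G) auto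
next
  case False
  then show ?thesis by (simp add: order_0I)
qed

lemma complex_poly_dvdI:
  fixes p q :: "complex poly"
  assumes "p \<noteq> 0" "q \<noteq> 0" and le: "\<And>z. order z p \<le> order z q"
  shows "p dvd q"
proof -
  have roots: "{z. poly p z = 0} \<subseteq> {z. poly q z = 0}"
    using le assms(1,2) by (auto simp: order_root intro: less_le_trans)
  have "(\<Prod>z|poly p z = 0. [:-z, 1:] ^ order z p) dvd (\<Prod>z|poly p z = 0. [:-z, 1:] ^ order z q)"
    by (intro prod_dvd_prod le_imp_power_dvd le)
  also have "\<dots> dvd (\<Prod>z|poly q z = 0. [:-z, 1:] ^ order z q)"
    by (intro prod_dvd_prod_subset roots poly_roots_finite assms)
  also have "\<dots> dvd q"
    by (subst (2) complex_poly_decompose[symmetric]) (rule dvd_smult, rule dvd_refl)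
  finally show ?thesis
    using assms(1) by (subst complex_poly_decompose[symmetric]) (simp add: smult_dvd_iff)
qed

text \<open>
  The monic polynomial with the same roots as \<open>p\<close>, all of them simple.
\<close>

definition root_product :: "complex poly \<Rightarrow> complex poly" where
  "root_product p = (\<Prod>z|poly p z = 0. [:-z, 1:])"

lemma root_product:
  assumes "p \<noteq> 0"
  shows "degree (root_product p) = card {z. poly p z = 0}" "lead_coeff (root_product p) = 1"
    "root_product p \<noteq> 0" "order a (root_product p) = (if poly p a = 0 then 1 else 0)"
proof -
  have fin: "finite {z. poly p z = 0}" by (rule poly_roots_finite[OF assms])
  show nz: "root_product p \<noteq> 0" using fin by (simp add: root_product_def)
  show "degree (root_product p) = card {z. poly p z = 0}"
    unfolding root_product_def by (subst degree_prod_sum_eq) auto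
  show "lead_coeff (root_product p) = 1"
    by (simp add: root_product_def lead_coeff_prod)
  show "order a (root_product p) = (if poly p a = 0 then 1 else 0)"
  proof (cases "poly p a = 0")
    case True
    define r where "r = (\<Prod>z\<in>{z. poly p z = 0} - {a}. [:-z, 1:])"
    have eq: "root_product p = [:-a, 1:] * r"
      unfolding root_product_def r_def by (rule prod.remove) (use fin True in auto)
    have "poly r a \<noteq> 0" using fin by (simp add: r_def poly_prod)
    then have "order a r = 0" by (rule order_0I)
    moreover have "order a [:-a, 1:] = 1" using order_power_n_n[of a 1] by simp
    ultimately have "order a (root_product p) = 1"
      using nz unfolding eq by (subst order_mult) auto
    then show ?thesis using True by simp
  next
    case False
    then have "poly (root_product p) a \<noteq> 0" using fin by (auto simp: root_product_def poly_prod)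
    then show ?thesis using False by (simp add: order_0I)
  qed
qed

lemma matching_poly_dvd_path:
  assumes G: "simple_graph G" and p: "is_path G p" "p \<noteq> []"
  shows "matching_poly G dvd matching_poly (remove_verts G (set p)) * root_product (matching_poly G)"
proof (rule complex_poly_dvdI)
  let ?p = "matching_poly G" and ?q = "matching_poly (remove_verts G (set p))"
  note nz = degree_matching_poly(3)[OF G] degree_matching_poly(3)[OF simple_graph_remove_verts[OF G, of "set p"]]
  show "?p \<noteq> 0" "?q * root_product ?p \<noteq> 0" using nz root_product(3) by auto
  show "order z ?p \<le> order z (?q * root_product ?p)" for z
    using order_matching_poly_path[OF G p, of z] nz root_product(3)[OF nz(1)]
    by (cases "poly ?p z = 0") (auto simp: order_mult root_product(4) order_0I)
qed

lemma card_remove_path: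
  assumes "simple_graph G" and p: "is_path G p"
  shows "card (verts (remove_verts G (set p))) + length p = card (verts G)"
proof -
  have "card (set p) = length p" "set p \<subseteq> verts G" using p by (auto simp: is_path_def distinct_card)
  then show ?thesis using card_mono[OF finite_verts[OF assms(1)], of "set p"] by (simp add: card_Diff_subset)
qed

theorem path_length_le_num_matching_roots:
  assumes G: "simple_graph G" and p: "is_path G p"
  shows "length p \<le> num_matching_roots G"
proof (cases "p = []")
  case False
  let ?p = "matching_poly G" and ?q = "matching_poly (remove_verts G (set p))"
  note nz = degree_matching_poly(3)[OF G] degree_matching_poly(3)[OF simple_graph_remove_verts[OF G, of "set p"]]
  have "degree ?p \<le> degree (?q * root_product ?p)"
    by (rule dvd_imp_degree_le[OF matching_poly_dvd_path[OF G p False]]) (use nz root_product(3) in auto)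
  also have "\<dots> = degree ?q + num_matching_roots G"
    using nz root_product(1,3)[OF nz(1)] by (simp add: degree_mult_eq num_matching_roots_def)
  finally show ?thesis
    using card_remove_path[OF G p] degree_matching_poly(1)[OF G]
      degree_matching_poly(1)[OF simple_graph_remove_verts[OF G, of "set p"]] by simp
qed auto

lemma matching_poly_extremal_path:
  assumes G: "simple_graph G" and p: "is_path G p" "p \<noteq> []" and len: "length p = num_matching_roots G"
  shows "matching_poly G = matching_poly (remove_verts G (set p)) * root_product (matching_poly G)"
proof -
  let ?p = "matching_poly G" and ?q = "matching_poly (remove_verts G (set p))"
  let ?r = "?q * root_product ?p"
  note mp = degree_matching_poly[OF G] degree_matching_poly[OF simple_graph_remove_verts[OF G, of "set p"]]
  note rp = root_product[OF mp(3)]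
  obtain c where c: "?r = ?p * c" using matching_poly_dvd_path[OF G p] by (auto elim: dvdE)
  have nz: "?r \<noteq> 0" "c \<noteq> 0" using mp(6) rp(3) c by auto
  have "degree ?r = degree ?p"
    using mp rp(1,3) card_remove_path[OF G p(1)] len by (simp add: degree_mult_eq num_matching_roots_def)
  then have "degree c = 0" using nz mp(3) by (simp add: c degree_mult_eq)
  moreover have "lead_coeff c = 1"
    using arg_cong[OF c, of lead_coeff] by (simp add: lead_coeff_mult mp(2) mp(5) rp(2) del: lead_coeff_prod)
  ultimately have "c = 1" by (metis degree_eq_zeroE lead_coeff_pCons(2) pCons_one)
  with c show ?thesis by simp
qed

text \<open>
  Comparing orders at \<open>0\<close> in \<open>\<mu>(G) = \<mu>(G - p) \<cdot> D\<close>: with matching numbers \<open>\<nu>\<close> of \<open>G\<close> and \<open>\<nu>'\<close>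
  of \<open>G - p\<close>, and \<open>e = 1\<close> or \<open>e = 0\<close> according to whether \<open>0\<close> is a root, one gets
  \<open>2 * \<nu> + e = 2 * \<nu>' + length p\<close>. Parity then determines \<open>e\<close>.
\<close>

lemma extremal_path_matching:
  assumes G: "simple_graph G" and p: "is_path G p" "p \<noteq> []" and len: "length p = num_matching_roots G"
  shows "\<And>M. M \<in> all_matchings G \<Longrightarrow>
           \<exists>M'\<in>all_matchings (remove_verts G (set p)). card M \<le> card M' + length p div 2"
    and "even (length p) \<Longrightarrow> \<exists>M\<in>all_matchings G. 2 * card M = card (verts G)"
proof -
  let ?H = "remove_verts G (set p)"
  have H: "simple_graph ?H" using G by simp
  note mp = degree_matching_poly(3)[OF G] degree_matching_poly(3)[OF H]
  obtain M0 where M0: "M0 \<in> all_matchings G" "\<And>M. M \<in> all_matchings G \<Longrightarrow> card M \<le> card M0"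
    "order 0 (matching_poly G) = card (verts G) - 2 * card M0"
    by (rule maximum_matching[OF G]) blast
  obtain M1 where M1: "M1 \<in> all_matchings ?H" "order 0 (matching_poly ?H) = card (verts ?H) - 2 * card M1"
    by (rule maximum_matching[OF H]) blast
  have le: "2 * card M0 \<le> card (verts G)" "2 * card M1 \<le> card (verts ?H)"
    using matching_card_le[OF G M0(1)] matching_card_le[OF H M1(1)] by simp_all
  \<comment> \<open>the order of the squarefree factor at 0\<close>
  define e where "e = (if poly (matching_poly G) 0 = 0 then 1 else 0 :: nat)"
  \<comment> \<open>the factorisation along an extremal path, read off at the root 0\<close>
  have "order 0 (matching_poly G) = order 0 (matching_poly ?H) + order 0 (root_product (matching_poly G))"
    using mp root_product(3)[OF mp(1)]
    by (subst matching_poly_extremal_path[OF G p len]) (simp add: order_mult)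
  then have eq: "card (verts G) - 2 * card M0 = card (verts ?H) - 2 * card M1 + e"
    unfolding M0(3) M1(2) root_product(4)[OF mp(1)] e_def .
  have n: "card (verts ?H) + length p = card (verts G)" by (rule card_remove_path[OF G p(1)])
  have "2 * card M0 + e = 2 * card M1 + length p" using eq n le by linarith
  moreover have "e \<le> 1" by (simp add: e_def)
  ultimately have c: "card M0 \<le> card M1 + length p div 2" and e: "even (length p) \<Longrightarrow> e = 0"
    by presburger+
  show "\<exists>M'\<in>all_matchings ?H. card M \<le> card M' + length p div 2" if "M \<in> all_matchings G" for M
    using M1(1) c M0(2)[OF that] by (meson order_trans)
  show "\<exists>M\<in>all_matchings G. 2 * card M = card (verts G)" if "even (length p)"
  proof -
    have "order 0 (matching_poly G) = 0"
      using e[OF that] by (intro order_0I) (auto simp: e_def split: if_splits)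
    then show ?thesis using M0(1,3) le by (intro bexI[of _ M0]) auto
  qed
qed

text \<open>
  Cancelling the common factor \<open>D\<close> shows that \<open>G - p\<close> and \<open>G - q\<close> have the same matching
  polynomial, whose second leading coefficient counts edges.
\<close>

lemma extremal_path_edges:
  assumes G: "simple_graph G" and p: "is_path G p" "p \<noteq> []" "length p = num_matching_roots G"
    and q: "is_path G q" "q \<noteq> []" "length q = num_matching_roots G"
  shows "card (edges (remove_verts G (set p))) = card (edges (remove_verts G (set q)))"
proof -
  let ?P = "remove_verts G (set p)" and ?Q = "remove_verts G (set q)"
  have S: "simple_graph ?P" "simple_graph ?Q" using G by simp_all
  have eq: "matching_poly ?P = matching_poly ?Q"
    using matching_poly_extremal_path[OF G p] matching_poly_extremal_path[OF G q]
      root_product(3)[OF degree_matching_poly(3)[OF G]] by (metis mult_right_cancel)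
  have n: "card (verts ?P) = card (verts ?Q)"
    using card_remove_path[OF G p(1)] card_remove_path[OF G q(1)] p(3) q(3) by linarith
  have nm: "num_matchings H 1 = card (edges H)" if "simple_graph H" for H :: "'a ugraph"
    by (rule num_matchings_1[OF that])
  show ?thesis
  proof (cases "2 \<le> card (verts ?P)")
    case True
    then show ?thesis
      using coeff_matching_poly[OF S(1), of 1] coeff_matching_poly[OF S(2), of 1]
      unfolding eq n nm[OF S(1)] nm[OF S(2)] by simp
  next
    case False
    have "edges H = {}" if "simple_graph H" "card (verts H) < 2" for H :: "'a ugraph"
    proof (rule equals0I)
      fix e assume "e \<in> edges H"
      then have "{e} \<in> all_matchings H" by (simp add: all_matchings_def)
      from matching_card_le[OF that(1) this] that(2) show False by simp
    qed
    from this[OF S(1)] this[OF S(2)] show ?thesis using False n by (metis linorder_not_less)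
  qed
qed

section \<open>Graphs without long paths\<close>

definition adj :: "'a ugraph \<Rightarrow> 'a \<Rightarrow> 'a \<Rightarrow> bool" where
  "adj G u v \<longleftrightarrow> {u, v} \<in> edges G"

lemma adj_sym: "adj G u v \<Longrightarrow> adj G v u"
  by (simp add: adj_def insert_commute)

lemma adj_commute: "adj G u v \<longleftrightarrow> adj G v u"
  by (simp add: adj_def insert_commute)

lemma adj_verts: "simple_graph G \<Longrightarrow> adj G u v \<Longrightarrow> u \<in> verts G" "simple_graph G \<Longrightarrow> adj G u v \<Longrightarrow> v \<in> verts G"
  by (auto simp: adj_def dest: edge_in_verts)

lemma adj_irrefl: "simple_graph G \<Longrightarrow> \<not> adj G u u"
  by (simp add: adj_def no_loop)

lemma adj_neq: "simple_graph G \<Longrightarrow> adj G u v \<Longrightarrow> u \<noteq> v"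
  by (auto simp: adj_irrefl)

lemma edge_adjE:
  assumes "simple_graph G" "e \<in> edges G"
  obtains x y where "e = {x, y}" "adj G x y" "x \<noteq> y"
  using edgeE[OF assms] assms(2) by (metis adj_def)

lemma is_pathI:
  assumes "simple_graph G" "distinct xs" "successively (adj G) xs" "2 \<le> length xs"
  shows "is_path G xs"
proof -
  have "x \<in> verts G" if "x \<in> set xs" for x
  proof -
    from that obtain i where i: "i < length xs" "x = xs ! i" by (metis in_set_conv_nth)
    show ?thesis
    proof (cases "Suc i < length xs")
      case True
      then show ?thesis using successively_nth[OF assms(3) True] i adj_verts(1)[OF assms(1)] by metis
    next
      case False
      with i assms(4) obtain j where "i = Suc j" by (cases i) auto
      with i successively_nth[OF assms(3), of j] adj_verts(2)[OF assms(1)] show ?thesis by metis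
    qed
  qed
  then show ?thesis using assms by (auto simp: is_path_def adj_def)
qed

definition paths_bounded :: "'a ugraph \<Rightarrow> nat \<Rightarrow> bool" where
  "paths_bounded G k \<longleftrightarrow> (\<forall>xs. is_path G xs \<longrightarrow> length xs \<le> k)"

lemma paths_boundedD:
  assumes "paths_bounded G k" "simple_graph G" "distinct xs" "successively (adj G) xs" "k < length xs" "2 \<le> length xs"
  shows False
  using assms is_pathI[of G xs] by (auto simp: paths_bounded_def)

text \<open>
  All uses of connectivity are through this cut property.
\<close>

lemma connected_leaves:
  assumes G: "simple_graph G" "connected_graph G" and x: "x \<in> X" "x \<in> verts G" and y: "y \<notin> X" "y \<in> verts G"
  obtains a b where "a \<in> X" "b \<notin> X" "adj G a b"
proof -
  have "(x, y) \<in> {(x, y). adj G x y}\<^sup>*"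
    using G(2) x y by (auto simp: connected_graph_def adj_def)
  then have "x \<in> X \<Longrightarrow> y \<notin> X \<Longrightarrow> \<exists>a b. a \<in> X \<and> b \<notin> X \<and> adj G a b"
    by (induction rule: rtrancl_induct) auto
  with that x(1) y(1) show ?thesis by blast
qed

lemma obtain_outside:
  assumes "finite X" "card X < card (V :: 'a set)"
  obtains v where "v \<in> V" "v \<notin> X"
  using assms card_mono by (metis linorder_not_less subsetI)

text \<open>
  Every vertex is \<open>p2\<close> or a neighbour of it, since a vertex further away would extend to a path on
  four vertices. An edge between two neighbours of \<open>p2\<close> likewise leaves no room for a fourth vertex.
\<close>

lemma no_P4:
  assumes G: "simple_graph G" "connected_graph G" and b: "paths_bounded G 3"
    and p: "adj G p1 p2" "adj G p2 p3" "p1 \<noteq> p3"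
  shows "card (verts G) = 3 \<or> (\<forall>e\<in>edges G. p2 \<in> e)"
proof (rule disjCI)
  assume "\<not> (\<forall>e\<in>edges G. p2 \<in> e)"
  then obtain e where e: "e \<in> edges G" "p2 \<notin> e" by blast
  obtain x y where "e = {x, y}" "adj G x y" "x \<noteq> y" by (rule edge_adjE[OF G(1) e(1)])
  with e(2) have xy: "adj G x y" "x \<noteq> p2" "y \<noteq> p2" "x \<noteq> y" by auto
  have no4: False if "adj G a b" "adj G b c" "adj G c d" "distinct [a, b, c, d]" for a b c d
    by (rule paths_boundedD[OF b G(1), of "[a, b, c, d]"]) (use that in auto)
  note s = p(1,2)[THEN adj_sym] and neq = p(1,2)[THEN adj_neq[OF G(1)]]
  have V: "v = p2 \<or> adj G p2 v" if v: "v \<in> verts G" for v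
  proof (rule ccontr)
    assume "\<not> (v = p2 \<or> adj G p2 v)"
    then have "v \<notin> insert p2 {v. adj G p2 v}" by simp
    then obtain a b where ab: "a \<in> insert p2 {v. adj G p2 v}" "b \<notin> insert p2 {v. adj G p2 v}" "adj G a b"
      by (rule connected_leaves[OF G insertI1 adj_verts(1)[OF G(1) p(2)] _ v])
    then have a: "adj G b a" "adj G a p2" "a \<noteq> b" "a \<noteq> p2" "b \<noteq> p2"
      using adj_sym[of G p2 a] adj_sym[of G a b] adj_neq[OF G(1) ab(3)] adj_neq[OF G(1), of a p2] by auto
    have "b \<noteq> p1" "b \<noteq> p3" using ab(2) p s by auto
    then show False
      using no4[OF a(1,2), of p1] no4[OF a(1,2), of p3] a p s neq by auto
  qed
  have sub: "{p1, p2, p3} \<subseteq> verts G" using p adj_verts[OF G(1)] by blast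
  have c3: "card {p1, p2, p3} = 3" using p neq by (auto simp: card_insert_if)
  show "card (verts G) = 3"
  proof (rule ccontr)
    assume "card (verts G) \<noteq> 3"
    moreover have "card {p2, x, y} = 3" using xy by (auto simp: card_insert_if)
    ultimately have "card {p2, x, y} < card (verts G)"
      using card_mono[OF finite_verts[OF G(1)] sub] c3 by linarith
    then obtain z where z: "z \<in> verts G" "z \<notin> {p2, x, y}" by (rule obtain_outside[rotated]) auto
    have "adj G y p2" "adj G p2 z" using V[OF z(1)] V[of y] adj_verts[OF G(1) xy(1)] xy z adj_sym[of G p2 y] by auto
    then show False using no4[OF xy(1)] xy z by auto
  qed
qed

text \<open>
  A vertex outside the path can only be attached to an inner vertex, and only as a pendant; it then
  rules out the edge between the two ends, which is the only edge that could avoid both inner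
  vertices.
\<close>

lemma no_P5:
  assumes G: "simple_graph G" "connected_graph G" and b: "paths_bounded G 4" and n: "card (verts G) > 4"
    and p: "adj G p1 p2" "adj G p2 p3" "adj G p3 p4" "distinct [p1, p2, p3, p4]"
  shows "\<forall>e\<in>edges G. p2 \<in> e \<or> p3 \<in> e"
proof -
  let ?P = "{p1, p2, p3, p4}"
  note p' = p(1-3)[THEN adj_sym]
  have no5: False if "adj G a b" "adj G b c" "adj G c d" "adj G d e" "distinct [a, b, c, d, e]" for a b c d e
    by (rule paths_boundedD[OF b G(1), of "[a, b, c, d, e]"]) (use that in auto)
  have att: "x = p2 \<or> x = p3" if "q \<notin> ?P" "x \<in> ?P" "adj G q x" for q x
    using that no5[of q p1 p2 p3 p4] no5[of q p4 p3 p2 p1] p p' by auto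
  have far: "r \<in> ?P" if "q \<notin> ?P" "adj G q p2 \<or> adj G q p3" "adj G r q" for q r
    using that no5[of r q p2 p3 p4] no5[of r q p3 p2 p1] p p' adj_neq[OF G(1), of r q] by auto
  have pV: "p1 \<in> verts G" using adj_verts[OF G(1) p(1)] by simp
  have nbr: "adj G q p2 \<or> adj G q p3" if q: "q \<in> verts G" "q \<notin> ?P" for q
  proof (rule ccontr)
    let ?X = "?P \<union> {v. adj G v p2 \<or> adj G v p3}"
    assume "\<not> (adj G q p2 \<or> adj G q p3)"
    then have q': "q \<notin> ?X" using q by simp
    have p1: "p1 \<in> ?X" by simp
    obtain a b where ab: "a \<in> ?X" "b \<notin> ?X" "adj G a b"
      by (rule connected_leaves[OF G p1 pV q' q(1)])
    then show False using far[of a b] att[of b a] adj_sym[OF ab(3)] by blast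
  qed
  have "card ?P < card (verts G)" using n p(4) by simp
  then obtain q where q: "q \<in> verts G" "q \<notin> ?P" by (rule obtain_outside[rotated]) auto
  \<comment> \<open>otherwise the outside vertex \<open>q\<close> enters the cycle through the four vertices\<close>
  have no14: "\<not> adj G p1 p4"
    using nbr[OF q] q no5[of q p2 p1 p4 p3] no5[of q p3 p4 p1 p2] p p' adj_sym[of G p1 p4] by auto
  show ?thesis
  proof
    fix e assume "e \<in> edges G"
    then obtain x y where e: "e = {x, y}" "adj G x y" "x \<noteq> y" by (rule edge_adjE[OF G(1)])
    show "p2 \<in> e \<or> p3 \<in> e"
    proof (rule ccontr)
      assume not: "\<not> (p2 \<in> e \<or> p3 \<in> e)"
      consider "x \<in> ?P" "y \<in> ?P" | "x \<notin> ?P" | "y \<notin> ?P" by blast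
      then show False
      proof cases
        case 1
        then show ?thesis using not e no14 adj_sym[of G x y] by auto
      next
        case 2
        then show ?thesis
          using far[OF 2 nbr, of y] att[OF 2, of y] e not adj_sym[OF e(2)] adj_verts[OF G(1) e(2)] by auto
      next
        case 3
        then show ?thesis
          using far[OF 3 nbr, of x] att[OF 3, of x] e not adj_sym[OF e(2)] adj_verts[OF G(1) e(2)] by auto
      qed
    qed
  qed
qed

text \<open>
  Since there are no three disjoint edges, a vertex outside the path adjacent to \<open>p2\<close> is impossible:
  \<open>p1 p3\<close> and \<open>p4 p5\<close> would complete it to such a triple. Once a vertex hangs at \<open>p4\<close>, any edge
  from \<open>p5\<close> into the triangle gives another triple.
\<close>

lemma triangle_with_pendants:
  assumes G: "simple_graph G" and P: "distinct [p1, p2, p3, p4, p5]"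
    and p: "adj G p1 p2" "adj G p2 p3" "adj G p3 p4" "adj G p4 p5" and t: "adj G p1 p3"
    and no3: "\<And>a b c d e f. adj G a b \<Longrightarrow> adj G c d \<Longrightarrow> adj G e f \<Longrightarrow> distinct [a, b, c, d, e, f] \<Longrightarrow> False"
    and out: "\<And>q. q \<in> verts G \<Longrightarrow> q \<notin> {p1, p2, p3, p4, p5} \<Longrightarrow> adj G q p2 \<or> adj G q p4"
      "\<And>q v. q \<notin> {p1, p2, p3, p4, p5} \<Longrightarrow> adj G q v \<Longrightarrow> v = p2 \<or> v = p4"
    and q: "q \<in> verts G" "q \<notin> {p1, p2, p3, p4, p5}"
  shows "\<forall>w\<in>verts G - {p4, p1, p2, p3}. \<forall>v. adj G w v \<longleftrightarrow> v = p4"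
proof -
  let ?P = "{p1, p2, p3, p4, p5}"
  note s = p[THEN adj_sym] t[THEN adj_sym]
  have n2: "\<not> adj G w p2" if "w \<notin> ?P" for w
    using no3[of w p2 p1 p3 p4 p5] that p t P by auto
  have q4: "adj G q p4" using out(1)[OF q] n2[OF q(2)] by blast
  have "\<not> adj G p5 p1" "\<not> adj G p5 p2" "\<not> adj G p5 p3"
    using no3[OF q4, of p5 p1 p2 p3] no3[OF q4, of p5 p2 p1 p3] no3[OF q4, of p5 p3 p1 p2] q(2) p t P by auto
  moreover have "v \<in> ?P" if "adj G p5 v" for v
    using out(2)[of v p5] adj_sym[OF that] P by auto
  ultimately have 5: "adj G p5 v \<longleftrightarrow> v = p4" for v using s(4) adj_irrefl[OF G, of p5] by auto
  show ?thesis
  proof (intro ballI allI)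
    fix w v assume w: "w \<in> verts G - {p4, p1, p2, p3}"
    show "adj G w v \<longleftrightarrow> v = p4"
    proof (cases "w = p5")
      case False
      then have "w \<notin> ?P" using w by auto
      then show ?thesis using out(1)[of w] out(2)[of w v] n2[of w] w by auto
    qed (use 5 in simp)
  qed
qed

text \<open>
  Three disjoint edges are excluded by the matching number. Vertices outside the path can therefore
  see only \<open>p2\<close> and \<open>p4\<close>, so an edge that avoids both joins two of \<open>p1\<close>, \<open>p3\<close>, \<open>p5\<close>. The edge
  \<open>p1 p5\<close> would produce three disjoint edges, and each of the other two closes a triangle.
\<close>

lemma P5_all_edges_meet:
  assumes G: "simple_graph G" "connected_graph G" and n: "card (verts G) > 5"
    and P: "distinct [p1, p2, p3, p4, p5]"
    and p: "adj G p1 p2" "adj G p2 p3" "adj G p3 p4" "adj G p4 p5"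
    and meet: "edges (remove_verts G {p1, p2, p3, p4, p5}) = {}"
    and \<nu>: "\<And>M. M \<in> all_matchings G \<Longrightarrow> card M \<le> 2"
  shows "(\<forall>e\<in>edges G. p2 \<in> e \<or> p4 \<in> e) \<or>
    (\<exists>u x y z. distinct [u, x, y, z] \<and> adj G x y \<and> adj G y z \<and> adj G x z \<and> u \<in> verts G \<and>
      (\<forall>w\<in>verts G - {u, x, y, z}. \<forall>v. adj G w v \<longleftrightarrow> v = u))"
proof -
  let ?P = "{p1, p2, p3, p4, p5}"
  note s = p[THEN adj_sym]
  have no3: False if "adj G a b" "adj G c d" "adj G e f" "distinct [a, b, c, d, e, f]" for a b c d e f
  proof -
    have "{{a, b}, {c, d}, {e, f}} \<in> all_matchings G"
      using that by (auto simp: all_matchings_def adj_def pairwise_def disjnt_def)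
    from \<nu>[OF this] show False using that(4) by (simp add: card_insert_if doubleton_eq_iff)
  qed
  have in_P: "v \<in> ?P" if "q \<notin> ?P" "adj G q v" for q v
  proof (rule ccontr)
    assume "v \<notin> ?P"
    then have "{q, v} \<in> edges (remove_verts G ?P)" using that by (auto simp: adj_def)
    then show False using meet by blast
  qed
  have nb: "v = p2 \<or> v = p4" if "q \<notin> ?P" "adj G q v" for q v
    using in_P[OF that] that no3[of q p1 p2 p3 p4 p5] no3[of q p3 p1 p2 p4 p5] no3[of q p5 p1 p2 p3 p4] p P
    by auto
  have pV: "p1 \<in> verts G" using adj_verts[OF G(1) p(1)] by simp
  have nbr: "adj G q p2 \<or> adj G q p4" if q: "q \<in> verts G" "q \<notin> ?P" for q
  proof (rule ccontr)
    assume c: "\<not> (adj G q p2 \<or> adj G q p4)"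
    obtain a b where "a \<in> {q}" "b \<notin> {q}" "adj G a b"
      by (rule connected_leaves[OF G, of q "{q}" p1]) (use q pV in auto)
    then show False using c nb[OF q(2), of b] by auto
  qed
  have "card ?P < card (verts G)" using n P by simp
  then obtain q where q: "q \<in> verts G" "q \<notin> ?P" by (rule obtain_outside[rotated]) auto
  have no15: "\<not> adj G p1 p5"
    using nbr[OF q] no3[of q p2 p1 p5 p3 p4] no3[of q p4 p1 p5 p2 p3] p P q by auto
  consider "adj G p1 p3" | "adj G p5 p3" | "\<not> adj G p1 p3" "\<not> adj G p5 p3" by blast
  then show ?thesis
  proof cases
    case 1
    have "\<forall>w\<in>verts G - {p4, p1, p2, p3}. \<forall>v. adj G w v \<longleftrightarrow> v = p4"
      by (rule triangle_with_pendants[OF G(1) P p 1 no3 nbr nb q])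
    then have "distinct [p4, p1, p2, p3] \<and> adj G p1 p2 \<and> adj G p2 p3 \<and> adj G p1 p3 \<and> p4 \<in> verts G \<and>
      (\<forall>w\<in>verts G - {p4, p1, p2, p3}. \<forall>v. adj G w v \<longleftrightarrow> v = p4)"
      using p P 1 adj_verts[OF G(1) p(4)] by auto
    then show ?thesis by blast
  next
    case 2
    have "\<forall>w\<in>verts G - {p2, p5, p4, p3}. \<forall>v. adj G w v \<longleftrightarrow> v = p2"
      by (rule triangle_with_pendants[OF G(1) _ s(4,3,2,1) 2 no3 _ _ q(1)]) (use P nb nbr q in auto)
    then have "distinct [p2, p5, p4, p3] \<and> adj G p5 p4 \<and> adj G p4 p3 \<and> adj G p5 p3 \<and> p2 \<in> verts G \<and>
      (\<forall>w\<in>verts G - {p2, p5, p4, p3}. \<forall>v. adj G w v \<longleftrightarrow> v = p2)"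
      using s P 2 adj_verts[OF G(1) p(2)] by auto
    then show ?thesis by blast
  next
    case 3
    have "p2 \<in> e \<or> p4 \<in> e" if e: "e \<in> edges G" for e
    proof -
      obtain x y where xy: "e = {x, y}" "adj G x y" "x \<noteq> y" by (rule edge_adjE[OF G(1) e])
      consider "x \<in> ?P" "y \<in> ?P" | "x \<notin> ?P" | "y \<notin> ?P" by blast
      then show ?thesis
        by cases (use xy adj_sym[OF xy(2)] 3 no15 nb[of x y] nb[of y x] in auto)
    qed
    then show ?thesis by blast
  qed
qed

text \<open>
  The third arm leads into \<open>u\<close>; an edge between the first two arms allows a walk from \<open>u\<close> through
  three of their four vertices, and the result is a path on six vertices.
\<close>

lemma arms_not_adjacent:
  assumes G: "simple_graph G" and b: "paths_bounded G 5"
    and arms: "adj G u a1" "adj G a1 a2" "adj G u b1" "adj G b1 b2" "adj G u c1" "adj G c1 c2"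
      "distinct [u, a1, a2, b1, b2, c1, c2]"
    and xy: "x \<in> {a1, a2}" "y \<in> {b1, b2}"
  shows "\<not> adj G x y"
proof
  assume "adj G x y"
  note s = arms(1-6)[THEN adj_sym] this adj_sym[OF this]
  have no6: False if "adj G a b" "adj G b c" "adj G c d" "adj G d e" "adj G e f" "distinct [a, b, c, d, e, f]"
    for a b c d e f
    by (rule paths_boundedD[OF b G(1), of "[a, b, c, d, e, f]"]) (use that in auto)
  show False
    using xy no6[of c2 c1 u a1 a2 y] no6[of c2 c1 u b1 a1 a2] no6[of c2 c1 u b1 b2 a1] arms s by auto
qed

text \<open>
  A path \<open>u, x, y, z\<close> that misses an arm would be prolonged by this arm to six vertices. So its three
  vertices \<open>x\<close>, \<open>y\<close>, \<open>z\<close> lie one in each arm, although there is no edge between different arms.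
\<close>

lemma three_arms:
  assumes G: "simple_graph G" and b: "paths_bounded G 5"
    and arms: "adj G u a1" "adj G a1 a2" "adj G u b1" "adj G b1 b2" "adj G u c1" "adj G c1 c2"
      "distinct [u, a1, a2, b1, b2, c1, c2]"
    and xyz: "adj G u x" "adj G x y" "adj G y z" "distinct [u, x, y, z]"
  shows False
proof -
  note s = arms(1-6)[THEN adj_sym]
  have no6: False if "adj G a b" "adj G b c" "adj G c d" "adj G d e" "adj G e f" "distinct [a, b, c, d, e, f]"
    for a b c d e f
    by (rule paths_boundedD[OF b G(1), of "[a, b, c, d, e, f]"]) (use that in auto)
  have A: "{a1, a2} \<inter> {x, y, z} \<noteq> {}" using no6[of a2 a1 u x y z] arms xyz s by auto
  have B: "{b1, b2} \<inter> {x, y, z} \<noteq> {}" using no6[of b2 b1 u x y z] arms xyz s by auto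
  have C: "{c1, c2} \<inter> {x, y, z} \<noteq> {}" using no6[of c2 c1 u x y z] arms xyz s by auto
  have AB: "\<not> adj G v w" if "v \<in> {a1, a2}" "w \<in> {b1, b2}" for v w
    by (rule arms_not_adjacent[OF G b arms that])
  have BC: "\<not> adj G v w" if "v \<in> {b1, b2}" "w \<in> {c1, c2}" for v w
    by (rule arms_not_adjacent[OF G b arms(3-6) arms(1,2) _ that]) (use arms(7) in auto)
  have AC: "\<not> adj G v w" if "v \<in> {a1, a2}" "w \<in> {c1, c2}" for v w
    by (rule arms_not_adjacent[OF G b arms(1,2,5,6,3,4) _ that]) (use arms(7) in auto)
  have "y \<in> {a1, a2} \<or> y \<in> {b1, b2} \<or> y \<in> {c1, c2}" using A B C arms(7) by auto
  then show False
    using A B C arms(7) AB AC BC xyz xyz(2,3)[THEN adj_sym] by auto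
qed

text \<open>
  The vertices that have an edge outside the path form a set \<open>B\<close>; an edge leaving \<open>B\<close> must end on
  the path, and only at \<open>p3\<close> does it not create a path on six vertices.
\<close>

lemma P5_with_disjoint_edge:
  assumes G: "simple_graph G" "connected_graph G" and b: "paths_bounded G 5"
    and P: "distinct [p1, p2, p3, p4, p5]"
    and p: "adj G p1 p2" "adj G p2 p3" "adj G p3 p4" "adj G p4 p5"
    and ne: "edges (remove_verts G {p1, p2, p3, p4, p5}) \<noteq> {}"
  shows "\<exists>c d. adj G p3 c \<and> adj G c d \<and> distinct [p1, p2, p3, p4, p5, c, d]"
proof -
  let ?P = "{p1, p2, p3, p4, p5}"
  note s = p[THEN adj_sym]
  have no6: False if "adj G a b" "adj G b c" "adj G c d" "adj G d e" "adj G e f" "distinct [a, b, c, d, e, f]"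
    for a b c d e f
    by (rule paths_boundedD[OF b G(1), of "[a, b, c, d, e, f]"]) (use that in auto)
  define B where "B = {v. v \<notin> ?P \<and> (\<exists>w. w \<notin> ?P \<and> adj G v w)}"
  obtain e where e: "e \<in> edges G" "e \<inter> ?P = {}" using ne by auto
  obtain v w where vw: "e = {v, w}" "adj G v w" "v \<noteq> w" by (rule edge_adjE[OF G(1) e(1)])
  then have "v \<notin> ?P" "w \<notin> ?P" using e(2) by auto
  with vw(2) have v: "v \<in> B" "v \<in> verts G" using adj_verts[OF G(1)] by (auto simp: B_def)
  have "p1 \<notin> B" "p1 \<in> verts G" using adj_verts[OF G(1) p(1)] by (auto simp: B_def)
  then obtain c a where c: "c \<in> B" "a \<notin> B" "adj G c a" by (rule connected_leaves[OF G v])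
  then obtain d where d: "d \<notin> ?P" "adj G c d" "c \<notin> ?P" by (auto simp: B_def)
  have a: "a \<in> ?P" using c d adj_sym[OF c(3)] by (auto simp: B_def)
  have cd: "c \<noteq> d" using adj_neq[OF G(1) d(2)] .
  have "a = p3"
    using a no6[of d c p1 p2 p3 p4] no6[of d c p2 p3 p4 p5] no6[of d c p4 p3 p2 p1] no6[of d c p5 p4 p3 p2]
      c(3) d cd P p s adj_sym[OF d(2)] by auto
  then show ?thesis using c(3) d cd P adj_sym by (intro exI[of _ c] exI[of _ d]) auto
qed

section \<open>Stars attached to a vertex\<close>

text \<open>
  The graph arises from disjoint stars by joining \<open>u\<close> to all their centers, the elements of \<open>C\<close>, and
  perhaps to some leaves. A star may have no leaves. The assumption \<open>no_path\<close> restricts the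
  edges from \<open>u\<close> to leaves: only the leaf of a one-edge star can be adjacent to \<open>u\<close>.
\<close>

locale star_cone =
  fixes G :: "'a ugraph" and u :: 'a and C :: "'a set"
  assumes simple: "simple_graph G" and u: "u \<in> verts G"
    and center_adj: "\<And>c. c \<in> C \<Longrightarrow> adj G u c"
    and center_indep: "\<And>c d. c \<in> C \<Longrightarrow> d \<in> C \<Longrightarrow> \<not> adj G c d"
    and unique_center: "\<And>v. v \<in> verts G \<Longrightarrow> v \<noteq> u \<Longrightarrow> v \<notin> C \<Longrightarrow>
      \<exists>c\<in>C. \<forall>w. adj G v w \<and> w \<noteq> u \<longleftrightarrow> w = c"
    and no_path: "\<And>x y z. adj G u x \<Longrightarrow> adj G x y \<Longrightarrow> adj G y z \<Longrightarrow> distinct [u, x, y, z] \<Longrightarrow> False"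
begin

definition leaves :: "'a \<Rightarrow> 'a set" where
  "leaves c = {v. adj G c v \<and> v \<noteq> u}"

lemma center: assumes "c \<in> C" shows "c \<in> verts G" "c \<noteq> u"
  using center_adj[OF assms] adj_verts[OF simple] adj_neq[OF simple] by metis+

lemma leaf:
  assumes "c \<in> C" "v \<in> leaves c"
  shows "v \<in> verts G" "v \<noteq> u" "v \<notin> C" "adj G v c" "adj G c v" "v \<noteq> c"
  using assms center_indep[of c v] adj_verts[OF simple, of c v] adj_neq[OF simple, of c v] adj_sym[of G c v]
  by (auto simp: leaves_def)

lemma leaf_adj:
  assumes "c \<in> C" "v \<in> leaves c" "adj G v w" "w \<noteq> u"
  shows "w = c"
  using unique_center[OF leaf(1-3)[OF assms(1,2)]] leaf(4)[OF assms(1,2)] center(2)[OF assms(1)] assms(3,4)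
  by metis

lemma leaves_disjoint:
  assumes "c \<in> C" "d \<in> C" "v \<in> leaves c" "v \<in> leaves d"
  shows "c = d"
  using leaf_adj[OF assms(2,4) leaf(4)[OF assms(1,3)] center(2)[OF assms(1)]] .

lemma leaf_cases:
  assumes "v \<in> verts G" "v \<noteq> u" "v \<notin> C"
  obtains c where "c \<in> C" "v \<in> leaves c"
proof -
  obtain c where c: "c \<in> C" "\<forall>w. adj G v w \<and> w \<noteq> u \<longleftrightarrow> w = c" using unique_center[OF assms] by blast
  then have "v \<in> leaves c" using assms(2) adj_sym[of G v c] by (auto simp: leaves_def)
  with c(1) that show thesis by blast
qed

lemma edge_not_u:
  assumes "e \<in> edges G" "u \<notin> e"
  obtains c v where "c \<in> C" "v \<in> leaves c" "e = {c, v}"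
proof -
  obtain x y where xy: "e = {x, y}" "adj G x y" "x \<noteq> y" by (rule edge_adjE[OF simple assms(1)])
  have u': "x \<noteq> u" "y \<noteq> u" using assms(2) xy(1) by auto
  show thesis
  proof (cases "x \<in> C")
    case True
    then show ?thesis using that[of x y] xy u' by (auto simp: leaves_def)
  next
    case False
    obtain c where c: "c \<in> C" "x \<in> leaves c"
      by (rule leaf_cases[OF adj_verts(1)[OF simple xy(2)] u'(1) False])
    then show ?thesis using that[OF c] leaf_adj[OF c xy(2) u'(2)] xy(1) by auto
  qed
qed

lemma finite_C: "finite C" and finite_leaves: "finite (leaves c)"
  by (rule finite_subset[OF _ finite_verts[OF simple]], use center in blast)
    (rule finite_subset[OF _ finite_verts[OF simple]], use adj_verts[OF simple] in \<open>auto simp: leaves_def\<close>)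

lemma leaf_not_adj_u:
  assumes "c \<in> C" "v \<in> leaves c" "w \<in> leaves c" "v \<noteq> w"
  shows "\<not> adj G u v"
  using no_path[of v c w] leaf[OF assms(1,2)] leaf[OF assms(1,3)] assms(4) center(2)[OF assms(1)] by auto

lemma branch_path:
  assumes "c \<in> C" "d \<in> C" "c \<noteq> d" "x \<in> leaves c" "y \<in> leaves d"
  shows "is_path G [x, c, u, d, y]"
proof (rule is_pathI[OF simple])
  have "x \<noteq> y" using leaves_disjoint assms by metis
  then show "distinct [x, c, u, d, y]"
    using leaf[OF assms(1,4)] leaf[OF assms(2,5)] center[OF assms(1)] center[OF assms(2)] assms(1-3) by auto
  show "successively (adj G) [x, c, u, d, y]"
    using leaf[OF assms(1,4)] leaf[OF assms(2,5)] center_adj[OF assms(2)] adj_sym[OF center_adj[OF assms(1)]] by simp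
qed auto

lemma edges_remove_branch_path:
  assumes "c \<in> C" "d \<in> C" "x \<in> leaves c" "y \<in> leaves d"
  shows "edges (remove_verts G {x, c, u, d, y}) = (\<Union>b\<in>C - {c, d}. (\<lambda>v. {b, v}) ` leaves b)"
proof (intro equalityI subsetI)
  fix e assume e: "e \<in> edges (remove_verts G {x, c, u, d, y})"
  then have e': "e \<in> edges G" "u \<notin> e" by auto
  obtain b v where "b \<in> C" "v \<in> leaves b" "e = {b, v}" by (rule edge_not_u[OF e'])
  with e show "e \<in> (\<Union>b\<in>C - {c, d}. (\<lambda>v. {b, v}) ` leaves b)" by auto
next
  fix e assume "e \<in> (\<Union>b\<in>C - {c, d}. (\<lambda>v. {b, v}) ` leaves b)"
  then obtain b v where b: "b \<in> C" "b \<noteq> c" "b \<noteq> d" "v \<in> leaves b" "e = {b, v}" by auto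
  have "v \<noteq> x" "v \<noteq> y" using leaves_disjoint b assms by metis+
  then show "e \<in> edges (remove_verts G {x, c, u, d, y})"
    using b leaf[OF b(1,4)] center[OF b(1)] leaf(3)[OF assms(1,3)] leaf(3)[OF assms(2,4)] assms(1,2)
    by (auto simp: adj_def)
qed

lemma card_edges_remove_branch_path:
  assumes "c \<in> C" "d \<in> C" "x \<in> leaves c" "y \<in> leaves d"
  shows "card (edges (remove_verts G {x, c, u, d, y})) = (\<Sum>b\<in>C - {c, d}. card (leaves b))"
proof -
  have "card ((\<lambda>v. {b, v}) ` leaves b) = card (leaves b)" for b
    by (rule card_image) (auto simp: inj_on_def doubleton_eq_iff)
  moreover have "(\<lambda>v. {b, v}) ` leaves b \<inter> (\<lambda>v. {b', v}) ` leaves b' = {}"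
    if "b \<in> C" "b' \<in> C" "b \<noteq> b'" for b b'
    using that leaf(3)[OF that(2)] by (auto simp: doubleton_eq_iff)
  ultimately show ?thesis
    unfolding edges_remove_branch_path[OF assms]
    by (subst card_UN_disjoint) (use finite_C finite_leaves in auto)
qed

text \<open>
  The edges that remain after removing the path through the branches of \<open>c\<close> and \<open>d\<close> are those of the
  other stars. For five roots this path is extremal, and so is the one through \<open>c\<close> and \<open>e\<close>, so
  the stars of \<open>d\<close> and \<open>e\<close> have equally many edges.
\<close>

lemma leaves_card_eq:
  assumes z: "num_matching_roots G = 5"
    and "c \<in> C" "d \<in> C" "e \<in> C" "c \<noteq> d" "c \<noteq> e"
    and "leaves c \<noteq> {}" "leaves d \<noteq> {}" "leaves e \<noteq> {}"
  shows "card (leaves d) = card (leaves e)"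
proof -
  obtain x y w where l: "x \<in> leaves c" "y \<in> leaves d" "w \<in> leaves e" using assms by blast
  note p = branch_path[OF assms(2,3,5) l(1,2)] branch_path[OF assms(2,4,6) l(1,3)]
  have "card (edges (remove_verts G {x, c, u, d, y})) = card (edges (remove_verts G {x, c, u, e, w}))"
    using extremal_path_edges[OF simple p(1) _ _ p(2)] z by simp
  then have eq: "(\<Sum>b\<in>C - {c, d}. card (leaves b)) = (\<Sum>b\<in>C - {c, e}. card (leaves b))"
    using card_edges_remove_branch_path assms l by simp
  have "(\<Sum>b\<in>C. card (leaves b)) = card (leaves c) + (card (leaves a) + (\<Sum>b\<in>C - {c, a}. card (leaves b)))"
    if "a \<in> C" "c \<noteq> a" for a
    using that assms(2) finite_C
    by (simp add: sum.remove[of C c] sum.remove[of "C - {c}" a] Diff_insert2[symmetric] insert_commute)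
  from this[OF assms(3,5)] this[OF assms(4,6)] eq show ?thesis by simp
qed

text \<open>
  If \<open>b\<close> had no leaf, the edge \<open>u b\<close> together with one edge from each nontrivial star would be a
  matching. Removing the extremal path through \<open>c\<close> and \<open>d\<close> leaves a graph covered by the
  other nontrivial centers, so its matching number is smaller by at least three, whereas an extremal path on
  five vertices costs at most two.
\<close>

lemma no_bare_center:
  assumes z: "num_matching_roots G = 5"
    and cd: "c \<in> C" "d \<in> C" "c \<noteq> d" "leaves c \<noteq> {}" "leaves d \<noteq> {}" and b: "b \<in> C"
  shows "leaves b \<noteq> {}"
proof
  assume b0: "leaves b = {}"
  define C' where "C' = {c \<in> C. leaves c \<noteq> {}}"
  have fin: "finite C'" using finite_C by (simp add: C'_def)
  define l where "l c = (SOME v. v \<in> leaves c)" for c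
  have l: "l c \<in> leaves c" "c \<in> C" if "c \<in> C'" for c
    using that someI_ex[of "\<lambda>v. v \<in> leaves c"] by (auto simp: C'_def l_def)
  have bC': "b \<notin> C'" using b0 by (simp add: C'_def)
  let ?N = "(\<lambda>c. {c, l c}) ` C'"
  have "insert {u, b} ?N \<in> all_matchings G"
  proof -
    have "{c, l c} \<in> edges G" if "c \<in> C'" for c using leaf(5)[of c "l c"] l[OF that] by (simp add: adj_def)
    moreover have "{u, b} \<in> edges G" using center_adj[OF b] by (simp add: adj_def)
    moreover have "disjnt {c, l c} {d, l d}" if "c \<in> C'" "d \<in> C'" "c \<noteq> d" for c d
    proof -
      have "l c \<noteq> l d" using leaves_disjoint[OF l(2) l(2) l(1), of c d] l(1)[of d] that by auto
      then show ?thesis using leaf(3)[OF l(2,1)] l(2) that by (auto simp: disjnt_def)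
    qed
    moreover have "disjnt {u, b} {c, l c}" if "c \<in> C'" for c
      using leaf(2,3)[OF l(2,1)] center(2)[OF l(2)] that bC' b by (auto simp: disjnt_def)
    ultimately show ?thesis
      by (simp add: all_matchings_def pairwise_insert pairwise_image disjnt_sym image_subset_iff)
        (auto simp: pairwise_def)
  qed
  moreover obtain x y where xy: "x \<in> leaves c" "y \<in> leaves d" using cd by blast
  ultimately obtain M where M: "M \<in> all_matchings (remove_verts G {x, c, u, d, y})"
      "card (insert {u, b} ?N) \<le> card M + 2"
    using extremal_path_matching(1)[OF simple branch_path[OF cd(1-3) xy], of "insert {u, b} ?N"] z by auto
  have "inj_on (\<lambda>c. {c, l c}) C'" using leaf(3)[OF l(2,1)] l(2) by (auto simp: inj_on_def doubleton_eq_iff)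
  then have "card ?N = card C'" by (rule card_image)
  moreover have "{u, b} \<notin> ?N"
  proof
    assume "{u, b} \<in> ?N"
    then obtain c where c: "c \<in> C'" "u \<in> {c, l c}" by blast
    then show False using center(2)[OF l(2)[OF c(1)]] leaf(2)[OF l(2,1), OF c(1) c(1)] by auto
  qed
  ultimately have c1: "Suc (card C') \<le> card M + 2" using M(2) fin by simp
  have "e \<inter> (C' - {c, d}) \<noteq> {}" if "e \<in> edges (remove_verts G {x, c, u, d, y})" for e
    using that unfolding edges_remove_branch_path[OF cd(1,2) xy] by (auto simp: C'_def)
  then have "card M \<le> card (C' - {c, d})"
    by (intro matching_card_le_cover[OF M(1)]) (use fin in auto)
  moreover have "{c, d} \<subseteq> C'" using cd by (auto simp: C'_def)
  then have "card (C' - {c, d}) + 2 = card C'"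
    using card_mono[OF fin, of "{c, d}"] cd(3) by (simp add: card_Diff_subset)
  ultimately show False using c1 by simp
qed

end

text \<open>
  The centers are a maximal independent set of neighbours of \<open>u\<close>. Among the components of \<open>G - u\<close>,
  only a single edge with both ends adjacent to \<open>u\<close> contains more than one neighbour of \<open>u\<close>, and
  maximality picks exactly one end of it. No vertex is further than two steps from \<open>u\<close>.
\<close>

lemma star_cone_exists:
  assumes G: "simple_graph G" "connected_graph G" and u: "u \<in> verts G"
    and no: "\<And>x y z. adj G u x \<Longrightarrow> adj G x y \<Longrightarrow> adj G y z \<Longrightarrow> distinct [u, x, y, z] \<Longrightarrow> False"
  obtains C where "star_cone G u C"
proof -
  define N where "N = {v. adj G u v}"
  define F where "F = {C. C \<subseteq> N \<and> (\<forall>c\<in>C. \<forall>d\<in>C. \<not> adj G c d)}"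
  have "N \<subseteq> verts G" using adj_verts(2)[OF G(1)] by (auto simp: N_def)
  then have "finite N" using finite_verts[OF G(1)] finite_subset by blast
  then have "finite F" by (auto simp: F_def intro: finite_subset[of _ "Pow N"])
  moreover have "F \<noteq> {}" by (auto simp: F_def)
  ultimately obtain C where C: "C \<in> F" "\<forall>D\<in>F. C \<subseteq> D \<longrightarrow> C = D" using finite_has_maximal[of F] by auto
  have CN: "C \<subseteq> N" and ind: "\<And>c d. c \<in> C \<Longrightarrow> d \<in> C \<Longrightarrow> \<not> adj G c d" using C(1) by (auto simp: F_def)
  have uN: "v \<noteq> u" if "v \<in> N" for v using that adj_neq[OF G(1), of u v] by (auto simp: N_def)
  \<comment> \<open>a neighbour of \<open>u\<close> outside \<open>C\<close> is one end of a component of \<open>G - u\<close> with two vertices\<close>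
  have near: "\<exists>c\<in>C. \<forall>w. adj G v w \<and> w \<noteq> u \<longleftrightarrow> w = c" if v: "v \<in> N" "v \<notin> C" for v
  proof -
    have "insert v C \<notin> F" using C(2) v(2) by blast
    then obtain c where c: "c \<in> C" "adj G v c"
      using CN v(1) ind adj_irrefl[OF G(1), of v] adj_sym[of G _ v] by (auto simp: F_def)
    have "w = c" if "adj G v w" "w \<noteq> u" for w
      using no[of c v w] that c CN uN v adj_sym[OF c(2)] adj_neq[OF G(1) c(2)] adj_neq[OF G(1) that(1)]
      by (auto simp: N_def)
    then show ?thesis using c CN uN by blast
  qed
  have far: "\<exists>c\<in>C. \<forall>w. adj G v w \<and> w \<noteq> u \<longleftrightarrow> w = c" if v: "v \<in> verts G" "v \<noteq> u" "v \<notin> N" for v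
  proof -
    let ?X = "{u} \<union> N \<union> {v. \<exists>x\<in>N. adj G x v}"
    have "v \<in> ?X"
    proof (rule ccontr)
      assume vX: "v \<notin> ?X"
      have uX: "u \<in> ?X" by simp
      obtain a b where ab: "a \<in> ?X" "b \<notin> ?X" "adj G a b"
        by (rule connected_leaves[OF G uX u vX v(1)])
      then have "a \<noteq> u" "a \<notin> N" by (auto simp: N_def)
      with ab(1) obtain x where "x \<in> N" "adj G x a" by blast
      with ab \<open>a \<noteq> u\<close> \<open>a \<notin> N\<close> show False
        using no[of x a b] uN adj_neq[OF G(1), of a b] by (auto simp: N_def)
    qed
    with v obtain x where x: "x \<in> N" "adj G x v" by blast
    have w: "w = x" if "adj G v w" "w \<noteq> u" for w
      using no[of x v w] x that v(2) uN[OF x(1)] adj_neq[OF G(1) x(2)] adj_neq[OF G(1) that(1)]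
      by (auto simp: N_def)
    have "x \<in> C"
    proof (rule ccontr)
      assume "x \<notin> C"
      then have "v \<in> C" using near[OF x(1)] x(2) v(2) by metis
      with CN v(3) show False by blast
    qed
    then show ?thesis using w x uN adj_sym[OF x(2)] by blast
  qed
  have "star_cone G u C"
  proof
    show "\<exists>c\<in>C. \<forall>w. adj G v w \<and> w \<noteq> u \<longleftrightarrow> w = c" if "v \<in> verts G" "v \<noteq> u" "v \<notin> C" for v
      using near far that by blast
    show False if "adj G u x" "adj G x y" "adj G y z" "distinct [u, x, y, z]" for x y z
      using no that .
  qed (use G u CN ind in \<open>auto simp: N_def\<close>)
  then show thesis by (rule that)
qed

section \<open>Recognising the families\<close>

text \<open>
  The model graphs join the new vertex to the first few leaves, ends or copies. Numberings that place a
  given subset first translate arbitrary choices of neighbours into this normal form.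
\<close>

lemma bij_to_initial_segment:
  assumes "finite A" "B \<subseteq> A"
  obtains f :: "'a \<Rightarrow> nat" where "bij_betw f A {..<card A}" "\<And>x. x \<in> A \<Longrightarrow> x \<in> B \<longleftrightarrow> f x < card B"
proof -
  have finB: "finite B" using assms finite_subset by blast
  obtain g where g: "bij_betw g B {..<card B}" using ex_bij_betw_finite_nat[OF finB] by (auto simp: atLeast0LessThan)
  obtain h where h: "bij_betw h (A - B) {..<card (A - B)}"
    using ex_bij_betw_finite_nat[of "A - B"] assms(1) by (auto simp: atLeast0LessThan)
  have c: "card A = card B + card (A - B)" using assms finB card_mono[OF assms] by (simp add: card_Diff_subset)
  have h': "bij_betw (\<lambda>x. card B + h x) (A - B) {card B..<card A}"
  proof -
    have "bij_betw ((+) (card B)) {..<card (A - B)} {card B..<card A}"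
      by (rule bij_betw_byWitness[where f' = "\<lambda>i. i - card B"]) (auto simp: c)
    from bij_betw_trans[OF h this] show ?thesis by (simp add: o_def)
  qed
  let ?f = "\<lambda>x. if x \<in> B then g x else card B + h x"
  have "bij_betw ?f (B \<union> (A - B)) ({..<card B} \<union> {card B..<card A})"
    by (rule bij_betw_disjoint_Un[OF g h']) auto
  moreover have "B \<union> (A - B) = A" "{..<card B} \<union> {card B..<card A} = {..<card A}" using assms(2) c by auto
  ultimately have "bij_betw ?f A {..<card A}" by simp
  moreover have "x \<in> B \<longleftrightarrow> ?f x < card B" if "x \<in> A" for x
    using bij_betwE[OF g] by auto
  ultimately show thesis by (rule that)
qed

lemma image_mem_image_iff: "inj f \<Longrightarrow> f ` e \<in> (`) f ` E \<longleftrightarrow> e \<in> E"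
  by (simp add: image_iff inj_image_eq_iff)

text \<open>
  It suffices to recognise \<open>G - u\<close> and the neighbourhood of \<open>u\<close>.
\<close>

lemma add_vertex_isoI:
  assumes G: "simple_graph G" and u: "u \<in> verts G" and f: "bij_betw f (verts G - {u}) (verts H)"
    and e: "\<And>v w. v \<in> verts G \<Longrightarrow> w \<in> verts G \<Longrightarrow> v \<noteq> u \<Longrightarrow> w \<noteq> u \<Longrightarrow>
      adj G v w \<longleftrightarrow> {f v, f w} \<in> edges H"
    and S: "\<And>v. v \<in> verts G \<Longrightarrow> v \<noteq> u \<Longrightarrow> adj G u v \<longleftrightarrow> f v \<in> S"
  shows "G \<simeq>\<^sub>G add_vertex H S"
proof -
  define g where "g v = (if v = u then None else Some (f v))" for v
  have inj: "inj_on f (verts G - {u})" and im: "f ` (verts G - {u}) = verts H"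
    using f by (auto simp: bij_betw_def)
  have "bij_betw g (verts G) (verts (add_vertex H S))"
  proof (rule bij_betw_imageI)
    show "inj_on g (verts G)" using inj by (auto simp: inj_on_def g_def)
    have "g ` verts G = g ` insert u (verts G - {u})" using u by (simp add: insert_absorb)
    also have "\<dots> = insert None (Some ` f ` (verts G - {u}))" by (auto simp: g_def image_iff)
    finally show "g ` verts G = verts (add_vertex H S)" by (simp add: im add_vertex_def)
  qed
  moreover have "{v, w} \<in> edges G \<longleftrightarrow> {g v, g w} \<in> edges (add_vertex H S)"
    if vw: "v \<in> verts G" "w \<in> verts G" for v w
  proof -
    have some: "{Some a, Some b} \<in> edges (add_vertex H S) \<longleftrightarrow> {a, b} \<in> edges H" for a b
      using image_mem_image_iff[of Some "{a, b}" "edges H"] by (auto simp: add_vertex_def)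
    have none: "{None, Some a} \<in> edges (add_vertex H S) \<longleftrightarrow> a \<in> S" for a
      by (auto simp: add_vertex_def doubleton_eq_iff)
    have none2: "{None} \<notin> edges (add_vertex H S)"
      by (auto simp: add_vertex_def)
    consider "v = u" "w = u" | "v = u" "w \<noteq> u" | "v \<noteq> u" "w = u" | "v \<noteq> u" "w \<noteq> u" by blast
    then show ?thesis
    proof cases
      case 1 then show ?thesis using none2 no_loop[OF G] by (simp add: g_def)
    next
      case 2 then show ?thesis using none S vw by (simp add: g_def adj_def)
    next
      case 3
      then show ?thesis using none[of "f v"] S[of v] vw by (simp add: g_def adj_def insert_commute[of v u] insert_commute[of "Some _"])
    next
      case 4 then show ?thesis using some e vw by (simp add: g_def adj_def)
    qed
  qed
  ultimately show ?thesis by (auto simp: graph_iso_def)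
qed

lemma disjoint_union_edges [simp]:
  "{Inl a, Inl b} \<in> edges (disjoint_union G H) \<longleftrightarrow> {a, b} \<in> edges G"
  "{Inr c, Inr d} \<in> edges (disjoint_union G H) \<longleftrightarrow> {c, d} \<in> edges H"
  "{Inl a, Inr c} \<notin> edges (disjoint_union G H)" "{Inr c, Inl a} \<notin> edges (disjoint_union G H)"
proof -
  have "{Inl a, Inl b} \<notin> (`) Inr ` edges H" "{Inr c, Inr d} \<notin> (`) Inl ` edges G" by blast+
  then show "{Inl a, Inl b} \<in> edges (disjoint_union G H) \<longleftrightarrow> {a, b} \<in> edges G"
    "{Inr c, Inr d} \<in> edges (disjoint_union G H) \<longleftrightarrow> {c, d} \<in> edges H"
    using image_mem_image_iff[of Inl "{a, b}" "edges G"] image_mem_image_iff[of Inr "{c, d}" "edges H"]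
    by (simp_all add: disjoint_union_def)
  show "{Inl a, Inr c} \<notin> edges (disjoint_union G H)" "{Inr c, Inl a} \<notin> edges (disjoint_union G H)"
    unfolding disjoint_union_def by (simp_all, blast+)
qed

lemma disjoint_copies_edges [simp]:
  "{(i, a), (j, b)} \<in> edges (disjoint_copies r H) \<longleftrightarrow> i = j \<and> i < r \<and> {a, b} \<in> edges H"
proof
  assume "{(i, a), (j, b)} \<in> edges (disjoint_copies r H)"
  then obtain i' e where e: "{(i, a), (j, b)} = Pair i' ` e" "i' < r" "e \<in> edges H"
    unfolding disjoint_copies_def by force
  have "(i, a) \<in> Pair i' ` e" "(j, b) \<in> Pair i' ` e" unfolding e(1)[symmetric] by simp_all
  then have "i = i'" "j = i'" by auto
  moreover have "Pair i' ` {a, b} = Pair i' ` e" using e(1) \<open>i = i'\<close> \<open>j = i'\<close> by simp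
  then have "e = {a, b}" by (subst (asm) inj_image_eq_iff) (auto simp: inj_def)
  ultimately show "i = j \<and> i < r \<and> {a, b} \<in> edges H" using e by simp
next
  assume "i = j \<and> i < r \<and> {a, b} \<in> edges H"
  moreover have "{(i, a), (i, b)} = Pair i ` {a, b}" by simp
  ultimately show "{(i, a), (j, b)} \<in> edges (disjoint_copies r H)"
    unfolding disjoint_copies_def by (auto simp del: image_insert)
qed

lemma star_graph_edges [simp]:
  "{a, b} \<in> edges (star_graph k) \<longleftrightarrow> a = 0 \<and> b \<in> {1..k} \<or> b = 0 \<and> a \<in> {1..k}"
  by (auto simp: star_graph_def doubleton_eq_iff)

lemma bij_disjoint_union:
  assumes f: "bij_betw f A X" and g: "bij_betw g B Y" and AB: "A \<inter> B = {}"
  shows "bij_betw (\<lambda>v. if v \<in> A then Inl (f v) else Inr (g v)) (A \<union> B) (X <+> Y)"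
proof -
  have "bij_betw (\<lambda>v. if v \<in> A then Inl (f v) else Inr (g v)) (A \<union> B) (Inl ` X \<union> Inr ` Y)"
  proof (rule bij_betw_disjoint_Un[OF _ _ AB])
    show "bij_betw (\<lambda>v. Inl (f v)) A (Inl ` X)"
      using bij_betw_trans[OF f bij_betw_imageI[of Inl X "Inl ` X"]] by (auto simp: o_def)
    show "bij_betw (\<lambda>v. Inr (g v)) B (Inr ` Y)"
      using bij_betw_trans[OF g bij_betw_imageI[of Inr Y "Inr ` Y"]] by (auto simp: o_def)
  qed auto
  then show ?thesis by (simp add: Plus_def)
qed

lemma bij_star:
  assumes g: "bij_betw g B {..<k}" and c: "c \<notin> B"
  shows "bij_betw (\<lambda>v. if v = c then 0 else Suc (g v)) (insert c B) {0..k}"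
proof -
  have Suc: "bij_betw Suc {..<k} {1..k}"
    by (rule bij_betw_byWitness[where f' = "\<lambda>i. i - 1"]) auto
  have "bij_betw (\<lambda>v. if v \<in> {c} then 0 else (Suc \<circ> g) v) ({c} \<union> B) ({0} \<union> {1..k})"
    by (rule bij_betw_disjoint_Un[OF _ bij_betw_trans[OF g Suc]]) (use c in auto)
  moreover have "{0} \<union> {1..k} = {0..k}" by auto
  ultimately show ?thesis by (simp only: singleton_iff o_def insert_is_Un[of c B, symmetric])
qed

lemma star_iso:
  assumes G: "simple_graph G" "connected_graph G" and c: "c \<in> verts G" and n: "2 \<le> card (verts G)"
    and meet: "\<And>e. e \<in> edges G \<Longrightarrow> c \<in> e"
  shows "is_star G"
proof -
  let ?B = "verts G - {c}"
  have fin: "finite ?B" using finite_verts[OF G(1)] by simp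
  obtain g where g: "bij_betw g ?B {..<card ?B}" using bij_to_initial_segment[OF fin empty_subsetI] by blast
  let ?f = "\<lambda>v. if v = c then 0 else Suc (g v)"
  have f: "bij_betw ?f (verts G) (verts (star_graph (card ?B)))"
    using bij_star[OF g, of c] by (simp add: star_graph_def insert_absorb[OF c])
  have cv: "{c, v} \<in> edges G" if v: "v \<in> ?B" for v
  proof -
    obtain a b where ab: "a \<in> {v}" "b \<notin> {v}" "adj G a b"
      by (rule connected_leaves[OF G, of v "{v}" c]) (use v c in auto)
    then show ?thesis using meet[of "{a, b}"] v by (auto simp: adj_def insert_commute)
  qed
  have "{v, w} \<in> edges G \<longleftrightarrow> {?f v, ?f w} \<in> edges (star_graph (card ?B))"
    if "v \<in> verts G" "w \<in> verts G" for v w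
  proof -
    have "g v < card ?B" if "v \<in> ?B" for v using bij_betwE[OF g] that by auto
    then show ?thesis
      using that cv[of v] cv[of w] meet[of "{v, w}"] no_loop[OF G(1)]
      by (auto simp: insert_commute Suc_le_eq)
  qed
  with f have "G \<simeq>\<^sub>G star_graph (card ?B)" by (auto simp: graph_iso_def)
  moreover have "1 \<le> card ?B" using n c finite_verts[OF G(1)] by simp
  ultimately show ?thesis by (auto simp: is_star_def)
qed

text \<open>
  The vertex \<open>b\<close> and its neighbours \<open>B\<close> form the star, the vertices seen by \<open>a\<close> alone are the
  isolated ones, and \<open>a\<close> is the added vertex. The families \<open>K\<close> and \<open>K'\<close> differ by the edge \<open>a b\<close>; without it,
  connectedness forces a common neighbour. The neighbour \<open>c\<close> ensures that the star has an edge.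
\<close>

lemma cover_iso:
  assumes G: "simple_graph G" "connected_graph G" and ab: "a \<in> verts G" "b \<in> verts G" "a \<noteq> b"
    and cover: "\<And>e. e \<in> edges G \<Longrightarrow> a \<in> e \<or> b \<in> e"
    and c: "adj G b c" "c \<noteq> a"
  shows "(\<exists>k t l. 1 \<le> k \<and> 1 \<le> l \<and> l \<le> k \<and> G \<simeq>\<^sub>G graph_K k t l) \<or>
    (\<exists>k t l. 1 \<le> k \<and> l \<le> k \<and> G \<simeq>\<^sub>G graph_K' k t l)"
proof -
  define B where "B = {v. adj G b v \<and> v \<noteq> a}"
  define L where "L = {v \<in> B. adj G a v}"
  define T where "T = {v. adj G a v \<and> \<not> adj G b v \<and> v \<noteq> b}"
  have sub: "B \<subseteq> verts G" "T \<subseteq> verts G" using adj_verts[OF G(1)] by (auto simp: B_def T_def)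
  have fin: "finite B" "finite T" using sub finite_verts[OF G(1)] finite_subset by blast+
  have neq: "a \<notin> B" "b \<notin> B" "a \<notin> T" "b \<notin> T"
    using adj_irrefl[OF G(1)] by (auto simp: B_def T_def)
  have disj: "insert b B \<inter> T = {}" using neq by (auto simp: B_def T_def)
  have meet: "x = a \<or> x = b \<or> y = a \<or> y = b" if "adj G x y" for x y
    using cover[of "{x, y}"] that by (auto simp: adj_def)
  have V: "verts G - {a} = insert b B \<union> T"
  proof (intro equalityI subsetI)
    fix v assume v: "v \<in> verts G - {a}"
    obtain x y where xy: "x \<in> {v}" "y \<notin> {v}" "adj G x y"
      by (rule connected_leaves[OF G, of v "{v}" a]) (use v ab in auto)
    then have "adj G v y" "adj G y v" using adj_sym by auto
    then show "v \<in> insert b B \<union> T" using meet[of v y] v by (auto simp: B_def T_def)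
  next
    fix v assume "v \<in> insert b B \<union> T"
    then show "v \<in> verts G - {a}" using ab sub neq by auto
  qed
  obtain g where g: "bij_betw g B {..<card B}" "\<And>v. v \<in> B \<Longrightarrow> v \<in> L \<longleftrightarrow> g v < card L"
    by (rule bij_to_initial_segment[OF fin(1), of L]) (auto simp: L_def)
  obtain h where h: "bij_betw h T {..<card T}" by (rule bij_to_initial_segment[OF fin(2) empty_subsetI])
  define s where "s v = (if v = b then 0 else Suc (g v))" for v
  define f where "f v = (if v \<in> insert b B then Inl (s v) else Inr (h v))" for v
  let ?H = "disjoint_union (star_graph (card B)) (isolated_vertices (card T))"
  have s: "bij_betw s (insert b B) {0..card B}"
    unfolding s_def by (rule bij_star[OF g(1) neq(2)])
  have f: "bij_betw f (verts G - {a}) (verts ?H)"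
    unfolding V f_def using bij_disjoint_union[OF s h disj]
    by (simp add: disjoint_union_def star_graph_def isolated_vertices_def)
  have gB: "g v < card B" if "v \<in> B" for v using bij_betwE[OF g(1)] that by auto
  have hT: "h v < card T" if "v \<in> T" for v using bij_betwE[OF h] that by auto
  have edge: "adj G v w \<longleftrightarrow> {f v, f w} \<in> edges ?H"
    if vw: "v \<in> verts G" "w \<in> verts G" "v \<noteq> a" "w \<noteq> a" for v w
  proof -
    have vw': "v = b \<or> v \<in> B \<or> v \<in> T" "w = b \<or> w \<in> B \<or> w \<in> T" using V vw by auto
    have iso: "edges (isolated_vertices (card T)) = {}" by (simp add: isolated_vertices_def)
    have *: "adj G v w \<longleftrightarrow> v = b \<and> w \<in> B \<or> w = b \<and> v \<in> B"
      using meet[of v w] vw adj_sym[of G v w] adj_sym[of G b v] by (auto simp: B_def)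
    show ?thesis
      unfolding * using vw' neq gB disj by (auto simp: f_def s_def iso Suc_le_eq)
  qed
  have "c \<in> B" using c by (simp add: B_def)
  then have k: "1 \<le> card B" using fin by (auto simp: Suc_le_eq card_gt_0_iff)
  have l: "card L \<le> card B" by (rule card_mono) (use fin in \<open>auto simp: L_def\<close>)
  have fv: "f v \<in> {1..card L} <+> {..<card T} \<longleftrightarrow> adj G a v \<and> v \<noteq> b" if "v \<in> verts G" "v \<noteq> a" for v
  proof -
    have "v = b \<or> v \<in> B \<or> v \<in> T" using V that by auto
    then show ?thesis
      using g(2)[of v] hT[of v] neq disj by (auto simp: f_def s_def Suc_le_eq L_def T_def)
  qed
  show ?thesis
  proof (cases "adj G a b")
    case True
    have "adj G a v \<longleftrightarrow> f v \<in> insert 0 {1..card L} <+> {..<card T}" if v: "v \<in> verts G" "v \<noteq> a" for v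
    proof (cases "v = b")
      case True
      then show ?thesis using \<open>adj G a b\<close> by (simp add: f_def s_def InlI)
    next
      case False
      then have "f v \<noteq> Inl 0" by (simp add: f_def s_def)
      then show ?thesis using fv[OF v] False by auto
    qed
    from add_vertex_isoI[OF G(1) ab(1) f edge this] have "G \<simeq>\<^sub>G graph_K' (card B) (card T) (card L)"
      by (simp add: graph_K'_def)
    then show ?thesis using k l by blast
  next
    case False
    have "adj G a v \<longleftrightarrow> f v \<in> {1..card L} <+> {..<card T}" if "v \<in> verts G" "v \<noteq> a" for v
      using fv[OF that] False by auto
    from add_vertex_isoI[OF G(1) ab(1) f edge this] have iso: "G \<simeq>\<^sub>G graph_K (card B) (card T) (card L)"
      by (simp add: graph_K_def)
    have "L \<noteq> {}"
    proof
      assume L0: "L = {}"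
      obtain x y where xy: "x \<in> insert b B" "y \<notin> insert b B" "adj G x y"
        by (rule connected_leaves[OF G, of b "insert b B" a]) (use ab neq in auto)
      then show False using meet[of x y] L0 False adj_sym[OF xy(3)] by (auto simp: B_def L_def adj_sym)
    qed
    then have "1 \<le> card L" using fin by (auto simp: Suc_le_eq card_gt_0_iff L_def)
    then show ?thesis using k l iso by blast
  qed
qed

lemma complete_graph_edges [simp]:
  "{i, j} \<in> edges (complete_graph n) \<longleftrightarrow> i < n \<and> j < n \<and> i \<noteq> j"
  by (auto simp: complete_graph_def doubleton_eq_iff)

lemma complete_iso:
  assumes G: "simple_graph G" and all: "\<And>v w. v \<in> verts G \<Longrightarrow> w \<in> verts G \<Longrightarrow> v \<noteq> w \<Longrightarrow> adj G v w"
  shows "G \<simeq>\<^sub>G complete_graph (card (verts G))"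
proof -
  obtain f where f: "bij_betw f (verts G) {..<card (verts G)}"
    by (rule bij_to_initial_segment[OF finite_verts[OF G] empty_subsetI])
  have "{v, w} \<in> edges G \<longleftrightarrow> {f v, f w} \<in> edges (complete_graph (card (verts G)))"
    if "v \<in> verts G" "w \<in> verts G" for v w
    using all[OF that] that bij_betwE[OF f] bij_betw_imp_inj_on[OF f] no_loop[OF G]
    by (auto simp: adj_def inj_on_eq_iff)
  with f show ?thesis by (auto simp: graph_iso_def complete_graph_def)
qed

lemma triangle_iso:
  assumes G: "simple_graph G" "connected_graph G" and d: "distinct [u, x, y, z]"
    and t: "adj G x y" "adj G y z" "adj G x z" and u: "u \<in> verts G"
    and pend: "\<forall>w\<in>verts G - {u, x, y, z}. \<forall>v. adj G w v \<longleftrightarrow> v = u"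
  shows "\<exists>t l. l \<in> {1, 2, 3} \<and> G \<simeq>\<^sub>G graph_L t l"
proof -
  let ?A = "{x, y, z}"
  define L where "L = {v \<in> ?A. adj G u v}"
  define T where "T = verts G - {u, x, y, z}"
  have A: "?A \<subseteq> verts G" using t adj_verts[OF G(1)] by blast
  have finT: "finite T" using finite_verts[OF G(1)] by (simp add: T_def)
  have V: "verts G - {u} = ?A \<union> T" "?A \<inter> T = {}" using A d by (auto simp: T_def)
  have cA: "card ?A = 3" using d by simp
  obtain g where g: "bij_betw g ?A {..<card ?A}" "\<And>v. v \<in> ?A \<Longrightarrow> v \<in> L \<longleftrightarrow> g v < card L"
    by (rule bij_to_initial_segment[of ?A L]) (auto simp: L_def)
  obtain h where h: "bij_betw h T {..<card T}" by (rule bij_to_initial_segment[OF finT empty_subsetI])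
  define f where "f v = (if v \<in> ?A then Inl (g v) else Inr (h v))" for v
  let ?H = "disjoint_union (complete_graph 3) (isolated_vertices (card T))"
  have f: "bij_betw f (verts G - {u}) (verts ?H)"
    unfolding V f_def using bij_disjoint_union[OF g(1) h V(2)] cA
    by (simp add: disjoint_union_def complete_graph_def isolated_vertices_def)
  have g3: "g v < 3" if "v \<in> ?A" for v using bij_betwE[OF g(1)] that cA by auto
  have inj: "g v = g w \<longleftrightarrow> v = w" if "v \<in> ?A" "w \<in> ?A" for v w
    by (rule inj_on_eq_iff[OF bij_betw_imp_inj_on[OF g(1)] that])
  have hT: "h v < card T" if "v \<in> T" for v using bij_betwE[OF h] that by auto
  have adjA: "adj G v w \<longleftrightarrow> v \<noteq> w" if "v \<in> ?A" "w \<in> ?A" for v w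
    using that t t[THEN adj_sym] adj_irrefl[OF G(1)] by auto
  have adjT: "adj G w v \<longleftrightarrow> v = u" "adj G v w \<longleftrightarrow> v = u" if "w \<in> T" for v w
    using pend that adj_commute[of G v w] by (auto simp: T_def)
  have iso: "edges (isolated_vertices (card T)) = {}" by (simp add: isolated_vertices_def)
  have edge: "adj G v w \<longleftrightarrow> {f v, f w} \<in> edges ?H"
    if vw: "v \<in> verts G" "w \<in> verts G" "v \<noteq> u" "w \<noteq> u" for v w
  proof -
    consider "v \<in> ?A" "w \<in> ?A" | "v \<in> ?A" "w \<in> T" | "v \<in> T" "w \<in> ?A" | "v \<in> T" "w \<in> T"
      using V(1) vw by blast
    then show ?thesis
    proof cases
      case 1 then show ?thesis using adjA[OF 1] inj[OF 1] g3[OF 1(1)] g3[OF 1(2)]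
        by (simp add: f_def)
    next
      case 2 then show ?thesis using adjT(2)[OF 2(2)] V(2) vw by (auto simp: f_def)
    next
      case 3 then show ?thesis using adjT(1)[OF 3(1)] V(2) vw by (auto simp: f_def)
    next
      case 4
      then have "v \<notin> ?A" "w \<notin> ?A" using V(2) by auto
      then show ?thesis using adjT(1)[OF 4(1)] vw by (simp add: f_def iso)
    qed
  qed
  have S: "adj G u v \<longleftrightarrow> f v \<in> {..<card L} <+> {..<card T}" if v: "v \<in> verts G" "v \<noteq> u" for v
  proof (cases "v \<in> ?A")
    case True
    then show ?thesis using g(2)[OF True] by (auto simp: f_def L_def)
  next
    case False
    then have "v \<in> T" using v by (simp add: T_def)
    then show ?thesis using adjT(2)[of v u] hT False by (simp add: f_def InrI)
  qed
  have "card L \<le> card ?A" by (rule card_mono) (auto simp: L_def)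
  moreover have "L \<noteq> {}"
  proof
    assume L0: "L = {}"
    obtain a b where ab: "a \<in> ?A" "b \<notin> ?A" "adj G a b"
      by (rule connected_leaves[OF G, of x ?A u]) (use A u d in auto)
    then have "b \<in> T \<or> b = u" using adj_verts(2)[OF G(1) ab(3)] by (auto simp: T_def)
    then show False
    proof
      assume "b \<in> T"
      then show False using adjT(2)[of b a] ab d by auto
    next
      assume "b = u"
      then show False using ab L0 adj_sym[OF ab(3)] by (auto simp: L_def)
    qed
  qed
  then have "card L > 0" by (simp add: card_gt_0_iff L_def)
  ultimately have "card L \<in> {1, 2, 3}" unfolding cA by auto
  moreover have "G \<simeq>\<^sub>G graph_L (card T) (card L)"
    unfolding graph_L_def by (rule add_vertex_isoI[OF G(1) u f edge S])
  ultimately show ?thesis by blast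
qed

text \<open>
  Number the centers such that those in \<open>D\<close>, whose single leaf is adjacent to \<open>u\<close>, come first, and
  send the leaves of each center to \<open>1, \<dots>, k\<close>. Both families \<open>T\<close> and \<open>S\<close> are instances of the
  resulting graph, as \<open>D\<close> is empty unless the stars are single edges.
\<close>

lemma (in star_cone) equal_stars_iso:
  assumes k: "\<And>c. c \<in> C \<Longrightarrow> card (leaves c) = k" "1 \<le> k"
  defines "D \<equiv> {c \<in> C. \<exists>v\<in>leaves c. adj G u v}"
  shows "G \<simeq>\<^sub>G add_vertex (disjoint_copies (card C) (star_graph k))
      ({..<card C} \<times> {0} \<union> {..<card D} \<times> {1})"
    and "k = 1 \<or> D = {}"
proof -
  show k1: "k = 1 \<or> D = {}"
  proof (rule disjCI)
    assume "D \<noteq> {}"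
    then obtain c v where c: "c \<in> C" "v \<in> leaves c" "adj G u v" by (auto simp: D_def)
    then have "leaves c = {v}" using leaf_not_adj_u by blast
    then show "k = 1" using k(1)[OF c(1)] by simp
  qed
  obtain i where i: "bij_betw i C {..<card C}" "\<And>c. c \<in> C \<Longrightarrow> c \<in> D \<longleftrightarrow> i c < card D"
    by (rule bij_to_initial_segment[OF finite_C, of D]) (auto simp: D_def)
  have "\<exists>g. bij_betw g (leaves c) {..<k}" if "c \<in> C" for c
    using bij_to_initial_segment[OF finite_leaves empty_subsetI] k(1)[OF that] by metis
  then obtain g where g: "\<And>c. c \<in> C \<Longrightarrow> bij_betw (g c) (leaves c) {..<k}" by metis
  define q where "q v = (if v \<in> C then v else (THE c. c \<in> C \<and> v \<in> leaves c))" for v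
  define f where "f v = (i (q v), if v \<in> C then 0 else Suc (g (q v) v))" for v
  have qC [simp]: "q c = c" if "c \<in> C" for c using that by (simp add: q_def)
  have ql [simp]: "q v = c" if "c \<in> C" "v \<in> leaves c" for v c
    using that leaf(3)[OF that] leaves_disjoint by (auto simp: q_def intro!: the_equality)
  have cases: "v \<in> C \<or> (\<exists>c. c \<in> C \<and> v \<in> leaves c)" if "v \<in> verts G" "v \<noteq> u" for v
    using leaf_cases[OF that] by blast
  have fC: "f c = (i c, 0)" if "c \<in> C" for c using that by (simp add: f_def)
  have fl: "f v = (i c, Suc (g c v))" if "c \<in> C" "v \<in> leaves c" for c v
    using that leaf(3)[OF that] by (simp add: f_def)
  have ieq: "i c = i d \<longleftrightarrow> c = d" if "c \<in> C" "d \<in> C" for c d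
    using bij_betw_imp_inj_on[OF i(1)] that by (simp add: inj_on_eq_iff)
  have ilt: "i c < card C" if "c \<in> C" for c using bij_betwE[OF i(1)] that by auto
  have glt: "g c v < k" if "c \<in> C" "v \<in> leaves c" for c v using bij_betwE[OF g[OF that(1)]] that by auto
  let ?H = "disjoint_copies (card C) (star_graph k)"
  have f: "bij_betw f (verts G - {u}) (verts ?H)"
  proof (rule bij_betw_imageI)
    show "inj_on f (verts G - {u})"
    proof (rule inj_onI)
      fix v w assume v: "v \<in> verts G - {u}" and w: "w \<in> verts G - {u}" and eq: "f v = f w"
      have "v \<in> C \<or> (\<exists>c. c \<in> C \<and> v \<in> leaves c)" "w \<in> C \<or> (\<exists>c. c \<in> C \<and> w \<in> leaves c)"
        using cases v w by auto
      then show "v = w"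
      proof (elim disjE exE conjE)
        fix c d assume *: "c \<in> C" "v \<in> leaves c" "d \<in> C" "w \<in> leaves d"
        then have "c = d" "g c v = g c w" using eq by (auto simp: fl ieq)
        then show "v = w" using * bij_betw_imp_inj_on[OF g[OF *(1)]] by (auto simp: inj_on_eq_iff)
      qed (use eq in \<open>auto simp: fC fl ieq\<close>)
    qed
    show "f ` (verts G - {u}) = verts ?H"
    proof (intro equalityI subsetI)
      fix p assume "p \<in> f ` (verts G - {u})"
      then obtain v where "v \<in> verts G - {u}" "p = f v" by blast
      then have "p = f v" "v \<in> C \<or> (\<exists>c. c \<in> C \<and> v \<in> leaves c)" using cases[of v] by simp_all
      then show "p \<in> verts ?H"
        using ilt glt by (auto simp: fC fl disjoint_copies_def star_graph_def Suc_le_eq)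
    next
      fix p assume "p \<in> verts ?H"
      then obtain j m where p: "p = (j, m)" "j < card C" "m \<le> k"
        by (auto simp: disjoint_copies_def star_graph_def)
      then have "j \<in> i ` C" using i(1) by (simp add: bij_betw_def)
      then obtain c where c: "c \<in> C" "j = i c" by blast
      show "p \<in> f ` (verts G - {u})"
      proof (cases m)
        case 0
        then show ?thesis using p c center[OF c(1)] by (intro image_eqI[of _ _ c]) (auto simp: fC)
      next
        case (Suc l)
        then have "l \<in> g c ` leaves c" using g[OF c(1)] p(3) by (simp add: bij_betw_def)
        then obtain v where "v \<in> leaves c" "l = g c v" by blast
        then show ?thesis using p c Suc leaf[OF c(1)] by (intro image_eqI[of _ _ v]) (auto simp: fl)
      qed
    qed
  qed
  have edge: "adj G v w \<longleftrightarrow> {f v, f w} \<in> edges ?H"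
    if vw: "v \<in> verts G" "w \<in> verts G" "v \<noteq> u" "w \<noteq> u" for v w
  proof -
    have "v \<in> C \<or> (\<exists>c. c \<in> C \<and> v \<in> leaves c)" "w \<in> C \<or> (\<exists>c. c \<in> C \<and> w \<in> leaves c)"
      using cases vw by auto
    then show ?thesis
    proof (elim disjE exE conjE)
      assume "v \<in> C" "w \<in> C"
      then show ?thesis using center_indep star_graph_edges[of 0 0 k] by (simp add: fC)
    next
      fix c assume *: "v \<in> C" "c \<in> C" "w \<in> leaves c"
      have "adj G v w \<longleftrightarrow> v = c"
        using leaf_adj[OF *(2,3) adj_sym vw(3)] leaf(5)[OF *(2,3)] by auto
      then show ?thesis using * glt[OF *(2,3)] ilt by (auto simp: fC fl ieq)
    next
      fix c assume *: "w \<in> C" "c \<in> C" "v \<in> leaves c"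
      have "adj G v w \<longleftrightarrow> w = c"
        using leaf_adj[OF *(2,3) _ vw(4)] leaf(4)[OF *(2,3)] by auto
      then show ?thesis using * glt[OF *(2,3)] ilt by (auto simp: fC fl ieq)
    next
      fix c d assume *: "c \<in> C" "v \<in> leaves c" "d \<in> C" "w \<in> leaves d"
      have "\<not> adj G v w" using leaf_adj[OF *(1,2) _ vw(4)] leaf(3)[OF *(3,4)] *(1) by auto
      then show ?thesis using * by (simp add: fl)
    qed
  qed
  have S: "adj G u v \<longleftrightarrow> f v \<in> {..<card C} \<times> {0} \<union> {..<card D} \<times> {1}"
    if v: "v \<in> verts G" "v \<noteq> u" for v
  proof (cases "v \<in> C")
    case True
    then show ?thesis using center_adj ilt by (simp add: fC)
  next
    case False
    then obtain c where c: "c \<in> C" "v \<in> leaves c" using cases[OF v] by blast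
    have "adj G u v \<longleftrightarrow> c \<in> D \<and> g c v = 0"
    proof
      assume "adj G u v"
      then have "c \<in> D" using c by (auto simp: D_def)
      then show "c \<in> D \<and> g c v = 0" using k1 glt[OF c] by auto
    next
      assume *: "c \<in> D \<and> g c v = 0"
      then obtain w where w: "w \<in> leaves c" "adj G u w" by (auto simp: D_def)
      then show "adj G u v" using leaf_not_adj_u[OF c(1) w(1) c(2)] by blast
    qed
    then show ?thesis using i(2)[OF c(1)] by (auto simp: fl[OF c])
  qed
  show "G \<simeq>\<^sub>G add_vertex ?H ({..<card C} \<times> {0} \<union> {..<card D} \<times> {1})"
    by (rule add_vertex_isoI[OF simple u f edge S])
qed

section \<open>The classification\<close>

lemma paths_bounded_num_matching_roots:
  "simple_graph G \<Longrightarrow> paths_bounded G (num_matching_roots G)"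
  using path_length_le_num_matching_roots by (auto simp: paths_bounded_def)

lemma obtain_path:
  assumes "\<not> paths_bounded G k"
  obtains xs where "is_path G xs" "length xs = Suc k"
proof -
  obtain xs where xs: "is_path G xs" "k < length xs" using assms by (auto simp: paths_bounded_def not_le)
  have "successively (\<lambda>x y. {x, y} \<in> edges G) (take (Suc k) xs @ drop (Suc k) xs)"
    using xs(1) by (simp add: is_path_def)
  then have "successively (\<lambda>x y. {x, y} \<in> edges G) (take (Suc k) xs)"
    by (simp only: successively_append_iff)
  then have "is_path G (take (Suc k) xs)"
    using xs(1) set_take_subset[of "Suc k" xs] by (auto simp: is_path_def)
  then show thesis using xs(2) by (intro that[of "take (Suc k) xs"]) auto
qed

lemma path_4E:
  assumes "is_path G xs" "length xs = 4"
  obtains a b c d where "xs = [a, b, c, d]" "adj G a b" "adj G b c" "adj G c d" "distinct [a, b, c, d]"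
proof -
  obtain a b c d where xs: "xs = [a, b, c, d]" using assms(2) by (auto simp: eval_nat_numeral length_Suc_conv)
  show thesis by (rule that[OF xs]) (use assms(1) xs in \<open>auto simp: is_path_def adj_def\<close>)
qed

lemma path_5E:
  assumes "is_path G xs" "length xs = 5"
  obtains a b c d e where "xs = [a, b, c, d, e]" "adj G a b" "adj G b c" "adj G c d" "adj G d e"
    "distinct [a, b, c, d, e]"
proof -
  obtain a b c d e where xs: "xs = [a, b, c, d, e]"
    using assms(2) by (auto simp: eval_nat_numeral length_Suc_conv)
  show thesis by (rule that[OF xs]) (use assms(1) xs in \<open>auto simp: is_path_def adj_def\<close>)
qed

lemma obtain_P3:
  assumes G: "simple_graph G" "connected_graph G" and n: "3 \<le> card (verts G)"
  obtains a b c where "adj G a b" "adj G b c" "a \<noteq> c"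
proof -
  obtain x where x: "x \<in> verts G" using G(2) by (auto simp: connected_graph_def)
  have "card {x} < card (verts G)" using n by simp
  then obtain x' where x': "x' \<in> verts G" "x' \<notin> {x}" by (rule obtain_outside[rotated]) auto
  obtain x1 y where "x1 \<in> {x}" "y \<notin> {x}" "adj G x1 y"
    by (rule connected_leaves[OF G singletonI x x'(2,1)])
  then have y: "adj G x y" by simp
  have "card {x, y} < card (verts G)" using n by (simp add: card_insert_if)
  then obtain z where z: "z \<in> verts G" "z \<notin> {x, y}" by (rule obtain_outside[rotated]) auto
  have x_in: "x \<in> {x, y}" by simp
  obtain a b where ab: "a \<in> {x, y}" "b \<notin> {x, y}" "adj G a b"
    by (rule connected_leaves[OF G x_in x z(2,1)])
  show thesis using that[of y x b] that[of x y b] ab y adj_sym[OF y] by auto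
qed

lemma num_matching_roots_le_cover:
  assumes G: "simple_graph G" and K: "finite K" "\<And>e. e \<in> edges G \<Longrightarrow> e \<inter> K \<noteq> {}"
  shows "num_matching_roots G \<le> 2 * card K + 1"
  by (rule num_matching_roots_le_matching[OF G matching_card_le_cover[OF _ K]])

lemma num_matching_roots_no_P4:
  assumes G: "simple_graph G" "connected_graph G" and b: "paths_bounded G 3"
  shows "num_matching_roots G \<le> 3"
proof (cases "card (verts G) \<le> 3")
  case True
  then show ?thesis using num_matching_roots_le_verts[OF G(1)] by linarith
next
  case False
  then have n: "3 \<le> card (verts G)" by simp
  obtain p1 p2 p3 where p: "adj G p1 p2" "adj G p2 p3" "p1 \<noteq> p3" by (rule obtain_P3[OF G n])
  have "\<forall>e\<in>edges G. p2 \<in> e" using no_P4[OF G b p] False by simp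
  then have "num_matching_roots G \<le> 2 * card {p2} + 1"
    by (intro num_matching_roots_le_cover[OF G(1)]) auto
  then show ?thesis by simp
qed

lemma num_matching_roots_star:
  assumes G: "simple_graph G" and s: "is_star G"
  shows "num_matching_roots G \<le> 3"
proof -
  obtain k f where f: "bij_betw f (verts G) (verts (star_graph k))"
    "\<And>v w. v \<in> verts G \<Longrightarrow> w \<in> verts G \<Longrightarrow> {v, w} \<in> edges G \<longleftrightarrow> {f v, f w} \<in> edges (star_graph k)"
    using s by (auto simp: is_star_def graph_iso_def)
  have "0 \<in> f ` verts G" using f(1) by (simp add: bij_betw_def star_graph_def)
  then obtain c where c: "c \<in> verts G" "f c = 0" by fastforce
  have "e \<inter> {c} \<noteq> {}" if e: "e \<in> edges G" for e
  proof -
    obtain x y where xy: "e = {x, y}" "adj G x y" "x \<noteq> y" by (rule edge_adjE[OF G e])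
    have V: "x \<in> verts G" "y \<in> verts G" using adj_verts[OF G xy(2)] by auto
    have "f x = f c \<or> f y = f c" using f(2)[OF V] e xy(1) c(2) by auto
    then have "x = c \<or> y = c" using inj_on_eq_iff[OF bij_betw_imp_inj_on[OF f(1)]] V c(1) by metis
    then show ?thesis using xy(1) by auto
  qed
  then have "num_matching_roots G \<le> 2 * card {c} + 1"
    by (intro num_matching_roots_le_cover[OF G]) auto
  then show ?thesis by simp
qed

lemma two_roots:
  assumes G: "simple_graph G" "connected_graph G" and z: "num_matching_roots G = 2"
  shows "G \<simeq>\<^sub>G complete_graph 2"
proof -
  have b: "paths_bounded G 2" using paths_bounded_num_matching_roots[OF G(1)] z by simp
  have "\<not> 3 \<le> card (verts G)"
  proof
    assume "3 \<le> card (verts G)"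
    then obtain p1 p2 p3 where p: "adj G p1 p2" "adj G p2 p3" "p1 \<noteq> p3" by (rule obtain_P3[OF G])
    show False
      by (rule paths_boundedD[OF b G(1), of "[p1, p2, p3]"])
        (use p p(1,2)[THEN adj_neq[OF G(1)]] in auto)
  qed
  then have n: "card (verts G) = 2" using num_matching_roots_le_verts[OF G(1)] z by linarith
  have "adj G v w" if vw: "v \<in> verts G" "w \<in> verts G" "v \<noteq> w" for v w
  proof -
    have V: "verts G = {v, w}"
      using card_subset_eq[of "verts G" "{v, w}"] finite_verts[OF G(1)] vw n by simp
    have wv: "w \<notin> {v}" using vw(3) by simp
    obtain a b where "a \<in> {v}" "b \<notin> {v}" "adj G a b"
      by (rule connected_leaves[OF G singletonI vw(1) wv vw(2)])
    then show ?thesis using adj_verts(2)[OF G(1), of a b] V by auto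
  qed
  from complete_iso[OF G(1) this] show ?thesis by (simp add: n)
qed

lemma three_roots:
  assumes G: "simple_graph G" "connected_graph G" and z: "num_matching_roots G = 3"
  shows "is_star G \<or> G \<simeq>\<^sub>G complete_graph 3"
proof -
  have b: "paths_bounded G 3" using paths_bounded_num_matching_roots[OF G(1)] z by simp
  have n: "3 \<le> card (verts G)" using num_matching_roots_le_verts[OF G(1)] z by linarith
  obtain p1 p2 p3 where p: "adj G p1 p2" "adj G p2 p3" "p1 \<noteq> p3" by (rule obtain_P3[OF G n])
  note V = adj_verts[OF G(1) p(1)] adj_verts[OF G(1) p(2)]
  note neq = p(1,2)[THEN adj_neq[OF G(1)]]
  have star: "is_star G" if "\<forall>e\<in>edges G. p2 \<in> e"
    by (rule star_iso[OF G V(2)]) (use n that in auto)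
  show ?thesis
  proof (cases "\<forall>e\<in>edges G. p2 \<in> e")
    case False
    then have n3: "card (verts G) = 3" using no_P4[OF G b p] by blast
    then have VG: "verts G = {p1, p2, p3}"
      using card_subset_eq[of "verts G" "{p1, p2, p3}"] finite_verts[OF G(1)] V neq p(3) by simp
    obtain e where e: "e \<in> edges G" "p2 \<notin> e" using False by blast
    obtain x y where xy: "e = {x, y}" "adj G x y" "x \<noteq> y" by (rule edge_adjE[OF G(1) e(1)])
    have "adj G p1 p3"
      using adj_verts[OF G(1) xy(2)] VG e(2) xy adj_sym[OF xy(2)] by auto
    then have "adj G v w" if "v \<in> verts G" "w \<in> verts G" "v \<noteq> w" for v w
      using that p(1,2) p(1,2)[THEN adj_sym] adj_sym[of G p1 p3] unfolding VG by auto
    from complete_iso[OF G(1) this] show ?thesis by (simp add: n3)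
  qed (use star in blast)
qed

text \<open>
  There is a path on four vertices, and it is extremal, so \<open>G\<close> has a perfect matching. With more than
  four vertices two vertices would cover all edges, and a matching of size at most two could not
  be perfect.
\<close>

lemma four_roots:
  assumes G: "simple_graph G" "connected_graph G" and z: "num_matching_roots G = 4"
  shows "\<not> is_star G \<and> card (verts G) = 4"
proof -
  have b: "paths_bounded G 4" using paths_bounded_num_matching_roots[OF G(1)] z by simp
  have "\<not> paths_bounded G 3" using num_matching_roots_no_P4[OF G] z by auto
  then obtain xs where xs: "is_path G xs" "length xs = Suc 3" by (rule obtain_path)
  then have len: "length xs = 4" by simp
  obtain p1 p2 p3 p4 where p: "xs = [p1, p2, p3, p4]" "adj G p1 p2" "adj G p2 p3" "adj G p3 p4"
    "distinct [p1, p2, p3, p4]" by (rule path_4E[OF xs(1) len])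
  have "xs \<noteq> []" using p(1) by simp
  then obtain M where M: "M \<in> all_matchings G" "2 * card M = card (verts G)"
    using extremal_path_matching(2)[OF G(1) xs(1)] len z by auto
  have "card (verts G) \<le> 4"
  proof (rule ccontr)
    assume "\<not> card (verts G) \<le> 4"
    then have "\<forall>e\<in>edges G. p2 \<in> e \<or> p3 \<in> e" by (intro no_P5[OF G b _ p(2-5)]) simp
    then have "card M \<le> card {p2, p3}" by (intro matching_card_le_cover[OF M(1)]) auto
    also have "\<dots> \<le> 2" by (simp add: card_insert_if)
    finally show False using M(2) \<open>\<not> card (verts G) \<le> 4\<close> by simp
  qed
  then show ?thesis
    using num_matching_roots_le_verts[OF G(1)] num_matching_roots_star[OF G(1)] z by fastforce
qed

lemma star_graph_1: "star_graph 1 = complete_graph 2"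
proof -
  have "{{i, j} |i j. i < 2 \<and> j < (2::nat) \<and> i \<noteq> j} = {{0, 1}}"
  proof (intro equalityI subsetI)
    fix e assume "e \<in> {{i, j} |i j. i < 2 \<and> j < (2::nat) \<and> i \<noteq> j}"
    then obtain i j :: nat where "e = {i, j}" "i < 2" "j < 2" "i \<noteq> j" by blast
    then show "e \<in> {{0, 1}}" by (auto simp: less_2_cases_iff)
  next
    fix e assume "e \<in> {{0, 1 :: nat}}"
    then have "e = {0, 1}" "(0 :: nat) < 2" "(1 :: nat) < 2" "(0 :: nat) \<noteq> 1" by simp_all
    then show "e \<in> {{i, j} |i j. i < 2 \<and> j < (2::nat) \<and> i \<noteq> j}" by blast
  qed
  moreover have "{0..1::nat} = {..<2}" "{{0, i} |i. i \<in> {1..1::nat}} = {{0, 1}}" by auto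
  ultimately show ?thesis unfolding star_graph_def complete_graph_def by simp
qed

text \<open>
  Any two centers are compared with the help of a third one, which is where three nontrivial stars are
  needed.
\<close>

lemma (in star_cone) three_branches_iso:
  assumes z: "num_matching_roots G = 5"
    and c: "c1 \<in> C" "c2 \<in> C" "c3 \<in> C" "distinct [c1, c2, c3]"
      "leaves c1 \<noteq> {}" "leaves c2 \<noteq> {}" "leaves c3 \<noteq> {}"
  shows "(\<exists>r k. 1 \<le> r \<and> 1 \<le> k \<and> G \<simeq>\<^sub>G graph_T r k) \<or>
    (\<exists>r s. 1 \<le> r \<and> r \<le> s \<and> s \<le> 2 * r \<and> G \<simeq>\<^sub>G graph_S r s)"
proof -
  have ne: "leaves b \<noteq> {}" if "b \<in> C" for b
    using no_bare_center[OF z c(1,2) _ c(5,6) that] c(4) by simp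
  have eq: "card (leaves a) = card (leaves c1)" if a: "a \<in> C" for a
  proof (cases "a = c1")
    case False
    define b where "b = (if a = c2 then c3 else c2)"
    have b: "b \<in> C" "b \<noteq> a" "b \<noteq> c1" using c(2-4) by (auto simp: b_def)
    show ?thesis by (rule leaves_card_eq[OF z b(1) a c(1) b(2,3) ne[OF b(1)] ne[OF a] c(5)])
  qed simp
  let ?k = "card (leaves c1)" and ?D = "{c \<in> C. \<exists>v\<in>leaves c. adj G u v}"
  have k: "1 \<le> ?k" using c(5) finite_leaves by (simp add: Suc_le_eq card_gt_0_iff)
  have r: "1 \<le> card C" using c(1) finite_C by (auto simp: Suc_le_eq card_gt_0_iff)
  have D: "card ?D \<le> card C" by (rule card_mono[OF finite_C]) auto
  note iso = equal_stars_iso[OF eq k]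
  show ?thesis
  proof (cases "?k = 1")
    case True
    then have "G \<simeq>\<^sub>G graph_S (card C) (card C + card ?D)"
      using iso(1) unfolding graph_S_def True star_graph_1 by simp
    then show ?thesis using r D
      by (intro disjI2 exI[of _ "card C"] exI[of _ "card C + card ?D"]) simp
  next
    case False
    then have D0: "?D = {}" using iso(2) by simp
    have "G \<simeq>\<^sub>G graph_T (card C) ?k" using iso(1) unfolding D0 graph_T_def by simp
    then show ?thesis using r k by blast
  qed
qed

text \<open>
  For \<open>K\<close> and \<open>K'\<close> the two cover vertices are either the inner vertices of a longest path on four
  vertices or the second and fourth vertex of a path on five vertices. In the remaining case the three disjoint
  edges at distance one from the middle vertex lie in different stars.
\<close>

lemma five_roots:
  assumes G: "simple_graph G" "connected_graph G" and z: "num_matching_roots G = 5"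
    and n: "card (verts G) > 5"
  shows "(\<exists>k t l. 1 \<le> k \<and> 1 \<le> l \<and> l \<le> k \<and> G \<simeq>\<^sub>G graph_K k t l) \<or>
    (\<exists>k t l. 1 \<le> k \<and> l \<le> k \<and> G \<simeq>\<^sub>G graph_K' k t l) \<or>
    (\<exists>t l. l \<in> {1, 2, 3} \<and> G \<simeq>\<^sub>G graph_L t l) \<or>
    (\<exists>r k. 1 \<le> r \<and> 1 \<le> k \<and> G \<simeq>\<^sub>G graph_T r k) \<or>
    (\<exists>r s. 1 \<le> r \<and> r \<le> s \<and> s \<le> 2 * r \<and> G \<simeq>\<^sub>G graph_S r s)"
proof -
  have b: "paths_bounded G 5" using paths_bounded_num_matching_roots[OF G(1)] z by simp
  have not3: "\<not> paths_bounded G 3" using num_matching_roots_no_P4[OF G] z by auto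
  show ?thesis
  proof (cases "paths_bounded G 4")
    case True
    obtain xs where xs: "is_path G xs" "length xs = Suc 3" by (rule obtain_path[OF not3])
    then have len: "length xs = 4" by simp
    obtain p1 p2 p3 p4 where p: "xs = [p1, p2, p3, p4]" "adj G p1 p2" "adj G p2 p3" "adj G p3 p4"
      "distinct [p1, p2, p3, p4]" by (rule path_4E[OF xs(1) len])
    have cover: "\<forall>e\<in>edges G. p2 \<in> e \<or> p3 \<in> e" by (rule no_P5[OF G True _ p(2-5)]) (use n in simp)
    have "(\<exists>k t l. 1 \<le> k \<and> 1 \<le> l \<and> l \<le> k \<and> G \<simeq>\<^sub>G graph_K k t l) \<or>
        (\<exists>k t l. 1 \<le> k \<and> l \<le> k \<and> G \<simeq>\<^sub>G graph_K' k t l)"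
      by (rule cover_iso[OF G adj_verts(1)[OF G(1) p(3)] adj_verts(2)[OF G(1) p(3)] _ _ p(4)])
        (use p(5) cover in auto)
    then show ?thesis by blast
  next
    case False
    then obtain xs where xs: "is_path G xs" "length xs = Suc 4" by (rule obtain_path)
    then have len: "length xs = 5" by simp
    obtain p1 p2 p3 p4 p5 where p: "xs = [p1, p2, p3, p4, p5]"
      "adj G p1 p2" "adj G p2 p3" "adj G p3 p4" "adj G p4 p5" "distinct [p1, p2, p3, p4, p5]"
      by (rule path_5E[OF xs(1) len])
    let ?P = "{p1, p2, p3, p4, p5}"
    have P: "set xs = ?P" "xs \<noteq> []" by (simp_all add: p(1))
    show ?thesis
    proof (cases "edges (remove_verts G ?P) = {}")
      case True
      have "card M \<le> 2" if M: "M \<in> all_matchings G" for M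
      proof -
        obtain M' where M': "M' \<in> all_matchings (remove_verts G ?P)" "card M \<le> card M' + 2"
          using extremal_path_matching(1)[OF G(1) xs(1) P(2) _ M] len z unfolding P(1) by auto
        have "M' = {}" using M'(1) True unfolding all_matchings_def by blast
        then show ?thesis using M'(2) by simp
      qed
      from P5_all_edges_meet[OF G n p(6,2-5) True this] show ?thesis
      proof
        assume cover: "\<forall>e\<in>edges G. p2 \<in> e \<or> p4 \<in> e"
        have "(\<exists>k t l. 1 \<le> k \<and> 1 \<le> l \<and> l \<le> k \<and> G \<simeq>\<^sub>G graph_K k t l) \<or>
            (\<exists>k t l. 1 \<le> k \<and> l \<le> k \<and> G \<simeq>\<^sub>G graph_K' k t l)"
          by (rule cover_iso[OF G adj_verts(1)[OF G(1) p(3)] adj_verts(1)[OF G(1) p(5)] _ _ p(5)])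
            (use p(6) cover in auto)
        then show ?thesis by blast
      next
        assume "\<exists>u x y z. distinct [u, x, y, z] \<and> adj G x y \<and> adj G y z \<and> adj G x z \<and> u \<in> verts G \<and>
          (\<forall>w\<in>verts G - {u, x, y, z}. \<forall>v. adj G w v \<longleftrightarrow> v = u)"
        then obtain u x y z where "distinct [u, x, y, z]" "adj G x y" "adj G y z" "adj G x z" "u \<in> verts G"
          "\<forall>w\<in>verts G - {u, x, y, z}. \<forall>v. adj G w v \<longleftrightarrow> v = u" by blast
        then have "\<exists>t l. l \<in> {1, 2, 3} \<and> G \<simeq>\<^sub>G graph_L t l" by (rule triangle_iso[OF G])
        then show ?thesis by blast
      qed
    next
      case ne: False
      obtain c d where cd: "adj G p3 c" "adj G c d" "distinct [p1, p2, p3, p4, p5, c, d]"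
        using P5_with_disjoint_edge[OF G b p(6,2-5) ne] by blast
      have no: False if "adj G p3 x" "adj G x y" "adj G y z" "distinct [p3, x, y, z]" for x y z
        by (rule three_arms[OF G(1) b adj_sym[OF p(3)] adj_sym[OF p(2)] p(4,5) cd(1,2) _ that])
          (use cd(3) in auto)
      obtain C where "star_cone G p3 C"
        by (rule star_cone_exists[OF G adj_verts(2)[OF G(1) p(3)] no])
      then interpret star_cone G p3 C .
      have e: "{p1, p2} \<in> edges G" "p3 \<notin> {p1, p2}" "{p4, p5} \<in> edges G" "p3 \<notin> {p4, p5}"
        "{c, d} \<in> edges G" "p3 \<notin> {c, d}"
        using p(2,5) cd by (auto simp: adj_def)
      obtain c1 v1 where 1: "c1 \<in> C" "v1 \<in> leaves c1" "{p1, p2} = {c1, v1}" by (rule edge_not_u[OF e(1,2)])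
      obtain c2 v2 where 2: "c2 \<in> C" "v2 \<in> leaves c2" "{p4, p5} = {c2, v2}" by (rule edge_not_u[OF e(3,4)])
      obtain c3 v3 where 3: "c3 \<in> C" "v3 \<in> leaves c3" "{c, d} = {c3, v3}" by (rule edge_not_u[OF e(5,6)])
      have "c1 \<in> {p1, p2}" "c2 \<in> {p4, p5}" "c3 \<in> {c, d}" unfolding 1(3) 2(3) 3(3) by simp_all
      then have "distinct [c1, c2, c3]" using cd(3) by auto
      then have "(\<exists>r k. 1 \<le> r \<and> 1 \<le> k \<and> G \<simeq>\<^sub>G graph_T r k) \<or>
          (\<exists>r s. 1 \<le> r \<and> r \<le> s \<and> s \<le> 2 * r \<and> G \<simeq>\<^sub>G graph_S r s)"
        by (rule three_branches_iso[OF z 1(1) 2(1) 3(1)]) (use 1 2 3 in auto)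
      then show ?thesis by blast
    qed
  qed
qed

theorem theorem8:
  fixes G :: "'a ugraph"
  assumes "simple_graph G" and "connected_graph G"
  shows "(num_matching_roots G = 2 \<longrightarrow> G \<simeq>\<^sub>G complete_graph 2) \<and>
         (num_matching_roots G = 3 \<longrightarrow> is_star G \<or> G \<simeq>\<^sub>G complete_graph 3) \<and>
         (num_matching_roots G = 4 \<longrightarrow>
            connected_graph G \<and> \<not> is_star G \<and> card (verts G) = 4) \<and>
         (num_matching_roots G = 5 \<longrightarrow>
            (\<exists>k t l. 1 \<le> k \<and> 1 \<le> l \<and> l \<le> k \<and> G \<simeq>\<^sub>G graph_K k t l) \<or>
            (\<exists>k t l. 1 \<le> k \<and> l \<le> k \<and> G \<simeq>\<^sub>G graph_K' k t l) \<or>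
            (\<exists>t l. l \<in> {1, 2, 3} \<and> G \<simeq>\<^sub>G graph_L t l) \<or>
            (\<exists>r k. 1 \<le> r \<and> 1 \<le> k \<and> G \<simeq>\<^sub>G graph_T r k) \<or>
            (\<exists>r s. 1 \<le> r \<and> r \<le> s \<and> s \<le> 2 * r \<and> G \<simeq>\<^sub>G graph_S r s) \<or>
            (connected_graph G \<and> \<not> is_star G \<and> card (verts G) = 5))"
proof (intro conjI impI)
  note G = assms
  show "G \<simeq>\<^sub>G complete_graph 2" if "num_matching_roots G = 2" by (rule two_roots[OF G that])
  show "is_star G \<or> G \<simeq>\<^sub>G complete_graph 3" if "num_matching_roots G = 3" by (rule three_roots[OF G that])
  show "connected_graph G" by (rule G(2))
  show "\<not> is_star G" "card (verts G) = 4" if "num_matching_roots G = 4" using four_roots[OF G that] by auto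
  assume z: "num_matching_roots G = 5"
  show "(\<exists>k t l. 1 \<le> k \<and> 1 \<le> l \<and> l \<le> k \<and> G \<simeq>\<^sub>G graph_K k t l) \<or>
            (\<exists>k t l. 1 \<le> k \<and> l \<le> k \<and> G \<simeq>\<^sub>G graph_K' k t l) \<or>
            (\<exists>t l. l \<in> {1, 2, 3} \<and> G \<simeq>\<^sub>G graph_L t l) \<or>
            (\<exists>r k. 1 \<le> r \<and> 1 \<le> k \<and> G \<simeq>\<^sub>G graph_T r k) \<or>
            (\<exists>r s. 1 \<le> r \<and> r \<le> s \<and> s \<le> 2 * r \<and> G \<simeq>\<^sub>G graph_S r s) \<or>
            (connected_graph G \<and> \<not> is_star G \<and> card (verts G) = 5)"
  proof (cases "card (verts G) > 5")
    case True
    then show ?thesis using five_roots[OF G z] by blast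
  next
    case False
    then have "card (verts G) = 5" using num_matching_roots_le_verts[OF G(1)] z by linarith
    moreover have "\<not> is_star G" using num_matching_roots_star[OF G(1)] z by auto
    ultimately show ?thesis using G(2) by blast
  qed
qed

end
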